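(* Let $E$ be a graph and $R$ a commutative ring with unit. Consider the commutative core $M_R(E)\subseteq L_R(E)$. Then $$M_R(E)=\{x\in L_R(E): xd=dx \text{ for every } d\in\Delta(E)\}.$$ Furthermore, $M_R(E)$ is a maximal commutative subalgebra of $L_R(E)$.
   Context: A graph $E=(E^0,E^1,r,s)$ consists of arbitrary sets $E^0$ (vertices), $E^1$ (edges) and maps $r,s:E^1\to E^0$. A vertex $v$ is regular if $s^{-1}(v)$ is finite and nonempty. A path is a vertex (length $0$, $s(v)=r(v)=v$) or a finite sequence $\mu=e_1\cdots e_n$ of edges with $r(e_i)=s(e_{i+1})$; $s(\mu)=s(e_1)$, $r(\mu)=r(e_n)$; $\mathrm{Path}(E)$ is the set of all paths. The Leavitt path algebra $L_R(E)$ is the universal $R$-algebra generated by pairwise orthogonal idempotents $\{v:v\in E^0\}$ and elements $\{e,e^*:e\in E^1\}$ subject to: $s(e)e=e=er(e)$; $r(e)e^*=e^*=e^*s(e)$; $e^*e=r(e)$ and $e^*f=0$ for $e\ne f$; $v=\sum_{s(e)=v}ee^*$ for every regular vertex $v$. For $\mu=e_1\cdots e_n$, $\mu^*=e_n^*\cdots e_1^*$ (and $v^*=v$). The $R$-linear involution on $L_R(E)$ is $(\sum r_i\alpha_i\beta_i^* )^*=\sum r_i\beta_i\alpha_i^*$. Put $G_E=\{\mu\nu^*:\mu,\nu\in\mathrm{Path}(E),\ r(\mu)=r(\nu)\}\subset L_R(E)$. An element $x$ is normal if $xx^*=x^*x$. $G_E^M$ is the set of normal elements of $G_E$, and the commutative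 core $M_R(E)$ is the $R$-subalgebra (not necessarily unital) of $L_R(E)$ generated by $G_E^M$. The diagonal algebra $\Delta(E)$ is the $R$-subalgebra of $L_R(E)$ generated by $\{\mu\mu^*:\mu\in\mathrm{Path}(E)\}$. A commutative subalgebra is maximal if it is not properly contained in another commutative $R$-subalgebra. *)

theory Defs
  imports "Graph_Theory.Arc_Walk" "HOL-Library.Poly_Mapping"
begin

section \<open>Graphs and paths\<close>

text \<open>
  Graphs are the digraphs \<open>wf_digraph\<close> of the AFP entry Graph\_Theory: arbitrary sets
  of vertices and arcs, loops and parallel arcs allowed, with source map \<open>tail\<close> and range
  map \<open>head\<close>.
\<close>

definition regular_vertex :: "('v, 'e) pre_digraph \<Rightarrow> 'v \<Rightarrow> bool" where
  "regular_vertex E v \<longleftrightarrow> v \<in> verts E \<and> finite (out_arcs E v) \<and> out_arcs E v \<noteq> {}"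

text \<open>
  A path is a triple (source, list of edges, range). The paths of length 0 are
  the triples \<open>(v, [], v)\<close> for a vertex \<open>v\<close>.
\<close>

type_synonym ('v, 'e) gpath = "'v \<times> 'e list \<times> 'v"

definition Path :: "('v, 'e) pre_digraph \<Rightarrow> ('v, 'e) gpath set" where
  "Path E = {(u, p, v). pre_digraph.awalk E u p v}"

definition path_range :: "('v, 'e) gpath \<Rightarrow> 'v" where
  "path_range \<mu> = snd (snd \<mu>)"


section \<open>The free algebra on the generators\<close>

datatype ('v, 'e) lgen = Vert 'v | Edge 'e | Ghost 'e

datatype 'g gword = Word (letters: "'g list")

text \<open>Words form a (noncommutative) monoid, written additively because the convolution
  product of finitely supported functions is defined over \<open>monoid_add\<close>.\<close>

instantiation gword :: (type) monoid_add
begin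

definition zero_gword :: "'a gword" where
  "zero_gword = Word []"

definition plus_gword :: "'a gword \<Rightarrow> 'a gword \<Rightarrow> 'a gword" where
  "plus_gword v w = Word (letters v @ letters w)"

instance
  by standard (auto simp: zero_gword_def plus_gword_def)

end

type_synonym ('v, 'e, 'r) free_alg = "('v, 'e) lgen gword \<Rightarrow>\<^sub>0 'r"

definition lgens :: "('v, 'e) pre_digraph \<Rightarrow> ('v, 'e) lgen set" where
  "lgens E = Vert ` verts E \<union> Edge ` arcs E \<union> Ghost ` arcs E"

text \<open>
  The coefficients live in \<open>{comm_ring, comm_monoid_mult}\<close>, i.e. in a commutative ring with
  unit; this is \<open>comm_ring_1\<close> without the axiom \<open>0 \<noteq> 1\<close>.

  Leavitt path algebras need not have a unit, so the free algebra is the nonunital one,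
  spanned by the nonempty words in the generators.
\<close>

definition free_lpa ::
  "('v, 'e) pre_digraph \<Rightarrow> ('v, 'e, 'r::{comm_ring, comm_monoid_mult}) free_alg set" where
  "free_lpa E = {p. \<forall>w \<in> Poly_Mapping.keys p. letters w \<noteq> [] \<and> set (letters w) \<subseteq> lgens E}"

definition word_mono ::
  "('v, 'e) lgen list \<Rightarrow> ('v, 'e, 'r::{comm_ring, comm_monoid_mult}) free_alg" where
  "word_mono gs = Poly_Mapping.single (Word gs) 1"

definition free_smult :: "'r::{comm_ring, comm_monoid_mult}
    \<Rightarrow> ('v, 'e, 'r) free_alg \<Rightarrow> ('v, 'e, 'r) free_alg" where
  "free_smult r p = Poly_Mapping.single 0 r * p"

fun gen_star :: "('v, 'e) lgen \<Rightarrow> ('v, 'e) lgen" where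
  "gen_star (Vert v) = Vert v"
| "gen_star (Edge e) = Ghost e"
| "gen_star (Ghost e) = Edge e"

definition word_star :: "('v, 'e) lgen gword \<Rightarrow> ('v, 'e) lgen gword" where
  "word_star w = Word (rev (map gen_star (letters w)))"

text \<open>
  The linear extension of \<open>word_star\<close>: since \<open>word_star\<close> is its own inverse, moving the
  coefficient of each word \<open>w\<close> to \<open>word_star w\<close> is precomposition with \<open>word_star\<close>.
\<close>

definition free_star ::
  "('v, 'e, 'r::{comm_ring, comm_monoid_mult}) free_alg \<Rightarrow> ('v, 'e, 'r) free_alg" where
  "free_star p = Poly_Mapping.map_key word_star p"


section \<open>The Leavitt path algebra\<close>

text \<open>A relation \<open>a = b\<close> is recorded as the element \<open>a - b\<close>.\<close>

inductive_set lpa_relations ::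
  "('v, 'e) pre_digraph \<Rightarrow> ('v, 'e, 'r::{comm_ring, comm_monoid_mult}) free_alg set"
  for E :: "('v, 'e) pre_digraph"
where
  vertex_idem: "v \<in> verts E \<Longrightarrow> word_mono [Vert v, Vert v] - word_mono [Vert v] \<in> lpa_relations E"
| vertex_orth: "v \<in> verts E \<Longrightarrow> w \<in> verts E \<Longrightarrow> v \<noteq> w \<Longrightarrow> word_mono [Vert v, Vert w] \<in> lpa_relations E"
| source_edge: "e \<in> arcs E \<Longrightarrow> word_mono [Vert (tail E e), Edge e] - word_mono [Edge e] \<in> lpa_relations E"
| edge_range: "e \<in> arcs E \<Longrightarrow> word_mono [Edge e, Vert (head E e)] - word_mono [Edge e] \<in> lpa_relations E"
| range_ghost: "e \<in> arcs E \<Longrightarrow> word_mono [Vert (head E e), Ghost e] - word_mono [Ghost e] \<in> lpa_relations E"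
| ghost_source: "e \<in> arcs E \<Longrightarrow> word_mono [Ghost e, Vert (tail E e)] - word_mono [Ghost e] \<in> lpa_relations E"
| CK1_same: "e \<in> arcs E \<Longrightarrow> word_mono [Ghost e, Edge e] - word_mono [Vert (head E e)] \<in> lpa_relations E"
| CK1_diff: "e \<in> arcs E \<Longrightarrow> f \<in> arcs E \<Longrightarrow> e \<noteq> f \<Longrightarrow> word_mono [Ghost e, Edge f] \<in> lpa_relations E"
| CK2: "regular_vertex E v \<Longrightarrow>
    word_mono [Vert v] - (\<Sum>e\<in>out_arcs E v. word_mono [Edge e, Ghost e]) \<in> lpa_relations E"

inductive_set lpa_ideal ::
  "('v, 'e) pre_digraph \<Rightarrow> ('v, 'e, 'r::{comm_ring, comm_monoid_mult}) free_alg set"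
  for E :: "('v, 'e) pre_digraph"
where
  rel: "p \<in> lpa_relations E \<Longrightarrow> p \<in> lpa_ideal E"
| zero: "0 \<in> lpa_ideal E"
| add: "p \<in> lpa_ideal E \<Longrightarrow> q \<in> lpa_ideal E \<Longrightarrow> p + q \<in> lpa_ideal E"
| smult: "p \<in> lpa_ideal E \<Longrightarrow> free_smult r p \<in> lpa_ideal E"
| mult_left: "a \<in> free_lpa E \<Longrightarrow> p \<in> lpa_ideal E \<Longrightarrow> a * p \<in> lpa_ideal E"
| mult_right: "a \<in> free_lpa E \<Longrightarrow> p \<in> lpa_ideal E \<Longrightarrow> p * a \<in> lpa_ideal E"

definition lpa_cong :: "('v, 'e) pre_digraph
    \<Rightarrow> (('v, 'e, 'r::{comm_ring, comm_monoid_mult}) free_alg \<times> ('v, 'e, 'r) free_alg) set" where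
  "lpa_cong E = {(p, q). p \<in> free_lpa E \<and> q \<in> free_lpa E \<and> p - q \<in> lpa_ideal E}"

type_synonym ('v, 'e, 'r) lpa_elt = "('v, 'e, 'r) free_alg set"

definition LPA ::
  "('v, 'e) pre_digraph \<Rightarrow> ('v, 'e, 'r::{comm_ring, comm_monoid_mult}) lpa_elt set" where
  "LPA E = free_lpa E // lpa_cong E"

definition lpa_class :: "('v, 'e) pre_digraph
    \<Rightarrow> ('v, 'e, 'r::{comm_ring, comm_monoid_mult}) free_alg \<Rightarrow> ('v, 'e, 'r) lpa_elt" where
  "lpa_class E p = lpa_cong E `` {p}"

definition lpa_zero ::
  "('v, 'e) pre_digraph \<Rightarrow> ('v, 'e, 'r::{comm_ring, comm_monoid_mult}) lpa_elt" where
  "lpa_zero E = lpa_class E 0"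

definition lpa_add :: "('v, 'e) pre_digraph \<Rightarrow> ('v, 'e, 'r::{comm_ring, comm_monoid_mult}) lpa_elt
    \<Rightarrow> ('v, 'e, 'r) lpa_elt \<Rightarrow> ('v, 'e, 'r) lpa_elt" where
  "lpa_add E x y = (\<Union>p\<in>x. \<Union>q\<in>y. lpa_class E (p + q))"

definition lpa_mult :: "('v, 'e) pre_digraph \<Rightarrow> ('v, 'e, 'r::{comm_ring, comm_monoid_mult}) lpa_elt
    \<Rightarrow> ('v, 'e, 'r) lpa_elt \<Rightarrow> ('v, 'e, 'r) lpa_elt" where
  "lpa_mult E x y = (\<Union>p\<in>x. \<Union>q\<in>y. lpa_class E (p * q))"

definition lpa_smult :: "('v, 'e) pre_digraph \<Rightarrow> 'r::{comm_ring, comm_monoid_mult}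
    \<Rightarrow> ('v, 'e, 'r) lpa_elt \<Rightarrow> ('v, 'e, 'r) lpa_elt" where
  "lpa_smult E r x = (\<Union>p\<in>x. lpa_class E (free_smult r p))"

definition lpa_star :: "('v, 'e) pre_digraph
    \<Rightarrow> ('v, 'e, 'r::{comm_ring, comm_monoid_mult}) lpa_elt \<Rightarrow> ('v, 'e, 'r) lpa_elt" where
  "lpa_star E x = (\<Union>p\<in>x. lpa_class E (free_star p))"


text \<open>
  The operations on classes are computed on representatives: the ideal is invariant under
  \<open>free_star\<close>, and the unions above are unions of a constant family.
\<close>

lemma pm_induct [case_names single sum]:
  fixes p :: "'a \<Rightarrow>\<^sub>0 'b::monoid_add"
  assumes "\<And>k v. P (Poly_Mapping.single k v)" "\<And>p q. P p \<Longrightarrow> P q \<Longrightarrow> P (p + q)"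
  shows "P p"
proof (induction p rule: update_induct)
  case const then show ?case using assms(1)[of undefined 0] by simp
next
  case (update f a b)
  have "Poly_Mapping.update a b f = f + Poly_Mapping.single a b"
    using update by (intro poly_mapping_eqI) (auto simp: lookup_update lookup_add lookup_single when_def in_keys_iff)
  then show ?case using update assms by simp
qed

lemma free_lpa_zero: "0 \<in> free_lpa E" by (simp add: free_lpa_def)

lemma free_lpa_add: "p \<in> free_lpa E \<Longrightarrow> q \<in> free_lpa E \<Longrightarrow> p + q \<in> free_lpa E"
  unfolding free_lpa_def using Poly_Mapping.keys_add[of p q] by blast

lemma free_lpa_diff: "p \<in> free_lpa E \<Longrightarrow> q \<in> free_lpa E \<Longrightarrow> p - q \<in> free_lpa E"
  unfolding free_lpa_def using keys_diff[of p q] by blast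

lemma free_lpa_mult: "p \<in> free_lpa E \<Longrightarrow> q \<in> free_lpa E \<Longrightarrow> p * q \<in> free_lpa E"
  unfolding free_lpa_def using keys_mult[of p q] by (fastforce simp: plus_gword_def)

lemma free_lpa_smult: "p \<in> free_lpa E \<Longrightarrow> free_smult r p \<in> free_lpa E"
  unfolding free_lpa_def free_smult_def
  using keys_mult[of "Poly_Mapping.single 0 r" p]
  by (fastforce simp: plus_gword_def zero_gword_def split: if_splits)

lemma free_lpa_sum: "(\<And>i. i \<in> A \<Longrightarrow> f i \<in> free_lpa E) \<Longrightarrow> sum f A \<in> free_lpa E"
  by (induction A rule: infinite_finite_induct) (auto intro: free_lpa_zero free_lpa_add)

lemma free_lpa_mono: "gs \<noteq> [] \<Longrightarrow> set gs \<subseteq> lgens E \<Longrightarrow> word_mono gs \<in> free_lpa E"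
  by (auto simp: free_lpa_def word_mono_def)

lemma lpa_relations_free:
  assumes "wf_digraph E" "p \<in> lpa_relations E" shows "p \<in> free_lpa E"
  using assms(2) wf_digraph.tail_in_verts[OF assms(1)] wf_digraph.head_in_verts[OF assms(1)]
  by (induction rule: lpa_relations.induct)
     (auto intro!: free_lpa_diff free_lpa_sum free_lpa_mono
       simp: lgens_def out_arcs_def regular_vertex_def)

lemma lpa_ideal_free:
  assumes "wf_digraph E" "p \<in> lpa_ideal E" shows "p \<in> free_lpa E"
  using assms(2)
  by (induction rule: lpa_ideal.induct)
     (auto intro: lpa_relations_free[OF assms(1)] free_lpa_zero free_lpa_add free_lpa_mult free_lpa_smult)

lemma free_smult_minus: "free_smult (- 1) p = - p"
proof -
  have "Poly_Mapping.single (0::('a,'b) lgen gword) (- 1 :: 'c) = - Poly_Mapping.single 0 1" by (simp add: single_uminus)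
  moreover have "Poly_Mapping.single 0 1 * p = p"
    by (induction p rule: pm_induct) (auto simp: mult_single distrib_left)
  ultimately show ?thesis by (simp add: free_smult_def)
qed

lemma lpa_ideal_uminus: "p \<in> lpa_ideal E \<Longrightarrow> - p \<in> lpa_ideal E"
  using lpa_ideal.smult[of p E "- 1"] by (simp add: free_smult_minus)

lemma lpa_ideal_diff: "p \<in> lpa_ideal E \<Longrightarrow> q \<in> lpa_ideal E \<Longrightarrow> p - q \<in> lpa_ideal E"
  using lpa_ideal.add[OF _ lpa_ideal_uminus, of p E q] by simp

lemma equiv_lpa_cong: "equiv (free_lpa E) (lpa_cong E)"
proof (rule equivI)
  show "lpa_cong E \<subseteq> free_lpa E \<times> free_lpa E" by (auto simp: lpa_cong_def)
  show "refl_on (free_lpa E) (lpa_cong E)" by (auto simp: refl_on_def lpa_cong_def lpa_ideal.zero)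
  show "sym (lpa_cong E)"
    by (rule symI) (auto simp: lpa_cong_def dest: lpa_ideal_uminus)
  show "trans (lpa_cong E)"
    by (rule transI) (auto simp: lpa_cong_def dest: lpa_ideal.add)
qed

lemma lpa_class_eq_iff:
  "p \<in> free_lpa E \<Longrightarrow> q \<in> free_lpa E \<Longrightarrow> lpa_class E p = lpa_class E q \<longleftrightarrow> p - q \<in> lpa_ideal E"
  using eq_equiv_class_iff[OF equiv_lpa_cong[of E], of p q]
  by (auto simp: lpa_class_def lpa_cong_def)

lemma LPA_eq_image: "LPA E = lpa_class E ` free_lpa E"
  by (auto simp: LPA_def lpa_class_def quotient_def)

lemma lpa_class_UN:
  assumes "p \<in> free_lpa E"
    and "\<And>p'. (p, p') \<in> lpa_cong E \<Longrightarrow> f p' = lpa_class E q"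
  shows "(\<Union>p'\<in>lpa_class E p. f p') = lpa_class E q"
proof -
  have "lpa_class E p \<noteq> {}"
    using assms(1) by (auto simp: lpa_class_def lpa_cong_def lpa_ideal.zero)
  moreover have "f p' = lpa_class E q" if "p' \<in> lpa_class E p" for p'
    using that assms(2) by (auto simp: lpa_class_def)
  ultimately show ?thesis by (simp add: UN_constant)
qed

lemma lpa_add_class:
  assumes "p \<in> free_lpa E" "q \<in> free_lpa E"
  shows "lpa_add E (lpa_class E p) (lpa_class E q) = lpa_class E (p + q)"
  unfolding lpa_add_def
proof (intro lpa_class_UN assms)
  fix p' q' assume a: "(p, p') \<in> lpa_cong E" "(q, q') \<in> lpa_cong E"
  have "(p' + q') - (p + q) = - ((p - p') + (q - q'))" by simp
  also have "\<dots> \<in> lpa_ideal E" using a by (intro lpa_ideal_uminus lpa_ideal.add) (auto simp: lpa_cong_def)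
  finally show "lpa_class E (p' + q') = lpa_class E (p + q)"
    using a by (subst lpa_class_eq_iff) (auto simp: lpa_cong_def intro: free_lpa_add)
qed

lemma lpa_mult_class:
  assumes "p \<in> free_lpa E" "q \<in> free_lpa E"
  shows "lpa_mult E (lpa_class E p) (lpa_class E q) = lpa_class E (p * q)"
  unfolding lpa_mult_def
proof (intro lpa_class_UN assms)
  fix p' q' assume a: "(p, p') \<in> lpa_cong E" "(q, q') \<in> lpa_cong E"
  have "p' * q' - p * q = - ((p - p') * q' + p * (q - q'))" by (simp add: algebra_simps)
  also have "\<dots> \<in> lpa_ideal E"
    using a by (intro lpa_ideal_uminus lpa_ideal.add lpa_ideal.mult_left lpa_ideal.mult_right)
      (auto simp: lpa_cong_def)
  finally show "lpa_class E (p' * q') = lpa_class E (p * q)"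
    using a by (subst lpa_class_eq_iff) (auto simp: lpa_cong_def intro: free_lpa_mult)
qed

lemma free_smult_diff: "free_smult r (p - q) = free_smult r p - free_smult r q"
  by (simp add: free_smult_def right_diff_distrib)

lemma lpa_smult_class:
  assumes "p \<in> free_lpa E"
  shows "lpa_smult E r (lpa_class E p) = lpa_class E (free_smult r p)"
  unfolding lpa_smult_def
proof (intro lpa_class_UN assms)
  fix p' assume a: "(p, p') \<in> lpa_cong E"
  have "free_smult r p' - free_smult r p = - free_smult r (p - p')"
    by (simp add: free_smult_diff)
  also have "\<dots> \<in> lpa_ideal E"
    using a by (intro lpa_ideal_uminus lpa_ideal.smult) (auto simp: lpa_cong_def)
  finally show "lpa_class E (free_smult r p') = lpa_class E (free_smult r p)"
    using a by (subst lpa_class_eq_iff) (auto simp: lpa_cong_def intro: free_lpa_smult)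
qed

lemma gen_star_invol [simp]: "gen_star (gen_star g) = g" by (cases g) auto
lemma word_star_invol [simp]: "word_star (word_star w) = w"
  by (cases w) (auto simp: word_star_def rev_map comp_def)
lemma inj_word_star: "inj word_star" by (metis injI word_star_invol)
lemma word_star_plus: "word_star (v + w) = word_star w + word_star v"
  by (simp add: word_star_def plus_gword_def)
lemma word_star_zero [simp]: "word_star 0 = 0"
  by (simp add: word_star_def zero_gword_def)

lemma free_star_single: "free_star (Poly_Mapping.single w r) = Poly_Mapping.single (word_star w) r"
  unfolding free_star_def using map_key_single[OF inj_word_star, of "word_star w" r] by simp

lemma free_star_add: "free_star (p + q) = free_star p + free_star q"
  unfolding free_star_def by (rule map_key_plus[OF inj_word_star])
lemma free_star_zero: "free_star 0 = 0"
  unfolding free_star_def by (simp add: map_key_zero[OF inj_word_star])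
lemma free_star_uminus: "free_star (- p) = - free_star p"
  using free_star_add[of p "- p"] by (simp add: free_star_zero eq_neg_iff_add_eq_0 add.commute)
lemma free_star_diff: "free_star (p - q) = free_star p - free_star q"
  using free_star_add[of p "- q"] by (simp add: free_star_uminus)
lemma free_star_sum: "free_star (sum f A) = (\<Sum>i\<in>A. free_star (f i))"
  by (induction A rule: infinite_finite_induct) (auto simp: free_star_add free_star_zero)

lemma free_star_mult: "free_star (p * q) = free_star q * free_star p"
proof (induction p rule: pm_induct)
  case (single w r)
  show ?case
    by (induction q rule: pm_induct)
      (auto simp: free_star_single mult_single word_star_plus mult.commute free_star_add distrib_left distrib_right)
next
  case (sum p q)
  then show ?case by (simp add: free_star_add distrib_left distrib_right)
qed

lemma free_smult_commute: "p * free_smult r q = free_smult r (p * q)"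
proof -
  have "p * Poly_Mapping.single 0 r = Poly_Mapping.single 0 r * p"
    by (induction p rule: pm_induct) (auto simp: mult_single mult.commute distrib_left distrib_right)
  then show ?thesis by (simp add: free_smult_def flip: mult.assoc)
qed

lemma free_star_smult: "free_star (free_smult r p) = free_smult r (free_star p)"
proof -
  have "q * Poly_Mapping.single 0 r = Poly_Mapping.single 0 r * q" for q :: "('a,'b,'c) free_alg"
    by (induction q rule: pm_induct) (auto simp: mult_single mult.commute distrib_left distrib_right)
  then show ?thesis by (simp add: free_smult_def free_star_mult free_star_single)
qed

lemma free_star_word_mono: "free_star (word_mono gs) = word_mono (rev (map gen_star gs))"
  by (simp add: word_mono_def free_star_single word_star_def)

lemma gen_star_lgens: "gen_star g \<in> lgens E \<longleftrightarrow> g \<in> lgens E"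
  by (cases g) (auto simp: lgens_def)

lemma free_star_free: "p \<in> free_lpa E \<Longrightarrow> free_star p \<in> free_lpa E"
  unfolding free_lpa_def free_star_def
proof (safe, goal_cases)
  case (1 w)
  then have "word_star w \<in> Poly_Mapping.keys p" by (simp add: keys_map_key[OF inj_word_star])
  then show ?case using 1 by (force simp: word_star_def)
next
  case (2 w g)
  then have "word_star w \<in> Poly_Mapping.keys p" by (simp add: keys_map_key[OF inj_word_star])
  moreover have "gen_star g \<in> set (letters (word_star w))" using 2 by (simp add: word_star_def)
  ultimately show ?case using 2 gen_star_lgens by blast
qed

lemma free_star_relation:
  "p \<in> lpa_relations E \<Longrightarrow> free_star p \<in> lpa_relations E"
  by (induction rule: lpa_relations.induct)
     (auto simp: free_star_diff free_star_sum free_star_word_mono intro: lpa_relations.intros)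

lemma free_star_ideal: "p \<in> lpa_ideal E \<Longrightarrow> free_star p \<in> lpa_ideal E"
  by (induction rule: lpa_ideal.induct)
     (auto simp: free_star_zero free_star_add free_star_smult free_star_mult
       intro: free_star_relation free_star_free lpa_ideal.intros)

lemma lpa_star_class:
  assumes "p \<in> free_lpa E"
  shows "lpa_star E (lpa_class E p) = lpa_class E (free_star p)"
  unfolding lpa_star_def
proof (intro lpa_class_UN assms)
  fix p' assume a: "(p, p') \<in> lpa_cong E"
  have "free_star p' - free_star p = - free_star (p - p')"
    by (simp add: free_star_diff)
  also have "\<dots> \<in> lpa_ideal E"
    using a by (intro lpa_ideal_uminus free_star_ideal) (auto simp: lpa_cong_def)
  finally show "lpa_class E (free_star p') = lpa_class E (free_star p)"
    using a by (subst lpa_class_eq_iff) (auto simp: lpa_cong_def intro: free_star_free)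
qed


section \<open>Subalgebras\<close>

text \<open>Subalgebras need not be unital; closure under negation is closure under the scalar \<open>-1\<close>.\<close>

definition lpa_subalgebra :: "('v, 'e) pre_digraph
    \<Rightarrow> ('v, 'e, 'r::{comm_ring, comm_monoid_mult}) lpa_elt set \<Rightarrow> bool" where
  "lpa_subalgebra E S \<longleftrightarrow> S \<subseteq> LPA E \<and> lpa_zero E \<in> S
     \<and> (\<forall>x\<in>S. \<forall>y\<in>S. lpa_add E x y \<in> S \<and> lpa_mult E x y \<in> S)
     \<and> (\<forall>r. \<forall>x\<in>S. lpa_smult E r x \<in> S)"

definition generated_subalgebra :: "('v, 'e) pre_digraph
    \<Rightarrow> ('v, 'e, 'r::{comm_ring, comm_monoid_mult}) lpa_elt set \<Rightarrow> ('v, 'e, 'r) lpa_elt set" where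
  "generated_subalgebra E X = \<Inter>{S. lpa_subalgebra E S \<and> X \<subseteq> S}"

definition commutative_subalgebra :: "('v, 'e) pre_digraph
    \<Rightarrow> ('v, 'e, 'r::{comm_ring, comm_monoid_mult}) lpa_elt set \<Rightarrow> bool" where
  "commutative_subalgebra E S \<longleftrightarrow>
     lpa_subalgebra E S \<and> (\<forall>x\<in>S. \<forall>y\<in>S. lpa_mult E x y = lpa_mult E y x)"

definition maximal_commutative_subalgebra :: "('v, 'e) pre_digraph
    \<Rightarrow> ('v, 'e, 'r::{comm_ring, comm_monoid_mult}) lpa_elt set \<Rightarrow> bool" where
  "maximal_commutative_subalgebra E S \<longleftrightarrow>
     commutative_subalgebra E S \<and> \<not> (\<exists>T. commutative_subalgebra E T \<and> S \<subset> T)"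


section \<open>The diagonal and the commutative core\<close>

text \<open>The image in the Leavitt path algebra of a path \<open>\<mu>\<close>; the element \<open>\<mu>\<^sup>*\<close>
  is \<open>lpa_star E (path_elt E \<mu>)\<close>.\<close>

fun path_elt :: "('v, 'e) pre_digraph \<Rightarrow> ('v, 'e) gpath
    \<Rightarrow> ('v, 'e, 'r::{comm_ring, comm_monoid_mult}) lpa_elt" where
  "path_elt E (u, p, v) = lpa_class E (word_mono (if p = [] then [Vert u] else map Edge p))"

definition path_monomials ::
  "('v, 'e) pre_digraph \<Rightarrow> ('v, 'e, 'r::{comm_ring, comm_monoid_mult}) lpa_elt set" where
  "path_monomials E = {lpa_mult E (path_elt E \<mu>) (lpa_star E (path_elt E \<nu>)) | \<mu> \<nu>.
     \<mu> \<in> Path E \<and> \<nu> \<in> Path E \<and> path_range \<mu> = path_range \<nu>}"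

definition lpa_normal :: "('v, 'e) pre_digraph
    \<Rightarrow> ('v, 'e, 'r::{comm_ring, comm_monoid_mult}) lpa_elt \<Rightarrow> bool" where
  "lpa_normal E x \<longleftrightarrow> lpa_mult E x (lpa_star E x) = lpa_mult E (lpa_star E x) x"

definition commutative_core ::
  "('v, 'e) pre_digraph \<Rightarrow> ('v, 'e, 'r::{comm_ring, comm_monoid_mult}) lpa_elt set" where
  "commutative_core E = generated_subalgebra E {x \<in> path_monomials E. lpa_normal E x}"

definition diagonal_algebra ::
  "('v, 'e) pre_digraph \<Rightarrow> ('v, 'e, 'r::{comm_ring, comm_monoid_mult}) lpa_elt set" where
  "diagonal_algebra E = generated_subalgebra E
     {lpa_mult E (path_elt E \<mu>) (lpa_star E (path_elt E \<mu>)) | \<mu>. \<mu> \<in> Path E}"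

end

theory Submission
  imports Defs "HOL-Library.Sublist"
begin

text \<open>
  Let \<open>x\<close> commute with the diagonal. Projecting onto a degree and applying the involution, one may
  assume that \<open>x\<close> is homogeneous of degree \<open>n \<ge> 0\<close>. For a path \<open>\<beta>\<close> with range \<open>v\<close> and a finite set
  \<open>A\<close> of edges leaving \<open>v\<close> put \<open>c = v - (\<Sum>e\<in>A. e e\<^sup>*)\<close>. If \<open>\<beta>\<close> is long, or if \<open>A\<close> contains the edges
  leaving \<open>v\<close> that occur in \<open>x\<close>, then \<open>\<beta>\<^sup>* x \<beta> c\<close> is a combination of elements \<open>\<kappa> c\<close> with closed
  paths \<open>\<kappa>\<close> of length \<open>n\<close> at \<open>v\<close>. If \<open>v\<close> emits at most one path of each length, then \<open>\<beta> \<kappa> \<beta>\<^sup>*\<close> is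
  normal. Otherwise some path \<open>\<delta>\<close> with \<open>c \<delta> = \<delta>\<close> is not a prefix of \<open>\<kappa> \<delta>\<close>, and
  \<open>(\<beta> \<kappa> \<delta>)\<^sup>* x (\<beta> \<delta>) = 0\<close> kills the coefficient of \<open>\<kappa>\<close>. Hence \<open>x \<beta> c \<beta>\<^sup>*\<close> lies in the commutative core,
  and downward induction on the length of \<open>\<beta>\<close> gives \<open>x \<beta> \<beta>\<^sup>*\<close> and finally \<open>x\<close> itself.

  Conversely a normal monomial is \<open>\<alpha> \<kappa> \<alpha>\<^sup>*\<close> or \<open>\<alpha> \<kappa>\<^sup>* \<alpha>\<^sup>*\<close> with a closed path \<open>\<kappa>\<close> that is trivial or has
  no exits, and any two of these commute. Maximality follows, since a commutative algebra containing
  the core centralizes the diagonal.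
\<close>

section \<open>Calculus of path monomials\<close>

text \<open>An abstract host for the argument: a ring type that contains images of the generators
  and may be larger than the algebra they generate. \<open>deg n\<close> is the projection onto
  degree \<open>n\<close>, with \<open>Ed e\<close> of degree 1. \<open>torsion_free\<close> is what
  allows coefficients to be read off.\<close>

locale leavitt_ring = wf_digraph E
  for E :: "('v, 'e) pre_digraph" +
  fixes V :: "'v \<Rightarrow> 'a::ring" and Ed :: "'e \<Rightarrow> 'a"
    and sc :: "'r::{comm_ring, comm_monoid_mult} \<Rightarrow> 'a \<Rightarrow> 'a"
    and star :: "'a \<Rightarrow> 'a" and deg :: "int \<Rightarrow> 'a \<Rightarrow> 'a"
  assumes V_mult: "u \<in> verts E \<Longrightarrow> v \<in> verts E \<Longrightarrow> V u * V v = (if u = v then V u else 0)"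
    and tail_Ed: "e \<in> arcs E \<Longrightarrow> V (tail E e) * Ed e = Ed e"
    and Ed_head: "e \<in> arcs E \<Longrightarrow> Ed e * V (head E e) = Ed e"
    and CK1: "e \<in> arcs E \<Longrightarrow> f \<in> arcs E \<Longrightarrow> star (Ed e) * Ed f = (if e = f then V (head E e) else 0)"
    and CK2: "regular_vertex E v \<Longrightarrow> V v = (\<Sum>e\<in>out_arcs E v. Ed e * star (Ed e))"
    and star_add: "star (x + y) = star x + star y"
    and star_mult: "star (x * y) = star y * star x"
    and star_star [simp]: "star (star x) = x"
    and star_V: "v \<in> verts E \<Longrightarrow> star (V v) = V v"
    and star_sc: "star (sc r x) = sc r (star x)"
    and sc_add: "sc r (x + y) = sc r x + sc r y"
    and sc_plus: "sc (r + s) x = sc r x + sc s x"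
    and sc_sc: "sc r (sc s x) = sc (r * s) x"
    and sc_one [simp]: "sc 1 x = x"
    and sc_mult_left: "sc r x * y = sc r (x * y)"
    and sc_mult_right: "x * sc r y = sc r (x * y)"
    and torsion_free: "v \<in> verts E \<Longrightarrow> sc r (V v) = 0 \<Longrightarrow> r = 0"
    and deg_add: "deg n (x + y) = deg n x + deg n y"
    and deg_sc: "deg n (sc r x) = sc r (deg n x)"
    and deg_V: "v \<in> verts E \<Longrightarrow> deg n (V v) = (if n = 0 then V v else 0)"
    and deg_Ed_left: "e \<in> arcs E \<Longrightarrow> deg n (Ed e * x) = Ed e * deg (n - 1) x"
    and deg_Ed_right: "e \<in> arcs E \<Longrightarrow> deg n (x * Ed e) = deg (n - 1) x * Ed e"
    and deg_V_left: "v \<in> verts E \<Longrightarrow> deg n (V v * x) = V v * deg n x"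
    and deg_V_right: "v \<in> verts E \<Longrightarrow> deg n (x * V v) = deg n x * V v"
    and deg_star_Ed_left: "e \<in> arcs E \<Longrightarrow> deg n (star (Ed e) * x) = star (Ed e) * deg (n + 1) x"
    and deg_star_Ed_right: "e \<in> arcs E \<Longrightarrow> deg n (x * star (Ed e)) = deg (n + 1) x * star (Ed e)"
begin

lemma sc_0_right [simp]: "sc r 0 = 0"
  using sc_add[of r 0 0] by simp
lemma sc_0_left [simp]: "sc 0 x = 0"
  using sc_plus[of 0 0 x] by simp
lemma sc_minus_one: "sc (- 1) x = - x"
  using sc_plus[of "- 1" 1 x] by (simp add: eq_neg_iff_add_eq_0)
lemma star_zero [simp]: "star 0 = 0"
  using star_add[of 0 0] by simp
lemma deg_zero [simp]: "deg n 0 = 0"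
  using deg_add[of n 0 0] by simp
lemma sc_sum: "sc r (sum f A) = (\<Sum>i\<in>A. sc r (f i))"
  by (induction A rule: infinite_finite_induct) (auto simp: sc_add)
lemma awalk_append: "awalk u p v \<Longrightarrow> awalk v q w \<Longrightarrow> awalk u (p @ q) w"
  by (induction p arbitrary: u) (auto simp: awalk_simps simp del: awalk_append_iff)

lemma awalk_appendE:
  assumes "awalk u (p @ q) w" obtains v where "awalk u p v" "awalk v q w"
  using assms by auto

lemma awalk_fun: "awalk u p v \<Longrightarrow> awalk u p w \<Longrightarrow> v = w"
  by auto

declare awalk_append_iff [simp del] awalkE [rule del]

lemma awalk_out_arcs: "awalk v (e # p) w \<Longrightarrow> e \<in> out_arcs E v"
  by (auto simp: awalk_simps)

lemma out_arcs_awalk: "e \<in> out_arcs E v \<Longrightarrow> awalk v [e] (head E e)"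
  by (auto simp: awalk_simps)

section \<open>Paths, ghost paths and their cylinder projections\<close>

text \<open>The recursion ends in the idempotent of the final vertex rather than in a unit, so the
  empty walk needs no separate case in products. The argument \<open>u\<close> affects the value
  only for the empty walk.\<close>

primrec pe :: "'v \<Rightarrow> 'e list \<Rightarrow> 'a" where
  "pe u [] = V u"
| "pe u (e # p) = Ed e * pe (head E e) p"

definition ge :: "'v \<Rightarrow> 'e list \<Rightarrow> 'a" where
  "ge u p = star (pe u p)"

definition cyl :: "'v \<Rightarrow> 'e list \<Rightarrow> 'a" where
  "cyl u p = pe u p * ge u p"

lemma star_pe: "star (pe u p) = ge u p" by (simp add: ge_def)
lemma star_ge [simp]: "star (ge u p) = pe u p" by (simp add: ge_def)
lemma star_cyl [simp]: "star (cyl u p) = cyl u p" by (simp add: cyl_def star_mult star_pe)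

lemma ge_Nil: "u \<in> verts E \<Longrightarrow> ge u [] = V u" by (simp add: ge_def star_V)
lemma ge_Cons: "ge u (e # p) = ge (head E e) p * star (Ed e)"
  by (simp add: ge_def star_mult)

lemma V_pe: "awalk u p w \<Longrightarrow> V u * pe u p = pe u p"
  by (cases p) (auto simp: awalk_simps V_mult tail_Ed simp flip: mult.assoc)

lemma pe_append: "awalk u p v \<Longrightarrow> awalk v q w \<Longrightarrow> pe u (p @ q) = pe u p * pe v q"
  by (induction p arbitrary: u) (auto simp: awalk_simps V_pe mult.assoc)

lemma pe_V: "awalk u p w \<Longrightarrow> pe u p * V w = pe u p"
  using pe_append[of u p w "[]" w] by (auto simp: awalk_Nil_iff)

lemma ge_append: "awalk u p v \<Longrightarrow> awalk v q w \<Longrightarrow> ge u (p @ q) = ge v q * ge u p"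
  by (simp add: ge_def pe_append star_mult)

declare star_pe [simp]

lemma ge_V: "awalk u p w \<Longrightarrow> ge u p * V u = ge u p"
  using arg_cong[OF V_pe, of u p w star] by (simp add: star_mult star_V awalk_hd_in_verts)

lemma V_ge: "awalk u p w \<Longrightarrow> V w * ge u p = ge u p"
  using arg_cong[OF pe_V, of u p w star] by (simp add: star_mult star_V awalk_last_in_verts)

lemma ge_pe_same: "awalk u p w \<Longrightarrow> ge u p * pe u p = V w"
proof (induction p arbitrary: u)
  case Nil then show ?case by (auto simp: awalk_simps V_mult ge_Nil)
next
  case (Cons e p)
  then have e: "e \<in> arcs E" "awalk (head E e) p w" by (auto simp: awalk_simps)
  have "ge u (e # p) * pe u (e # p) = ge (head E e) p * (star (Ed e) * Ed e) * pe (head E e) p"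
    by (simp add: ge_Cons mult.assoc)
  also have "\<dots> = V w" using e Cons.IH[OF e(2)] by (simp add: CK1 ge_V)
  finally show ?case .
qed

lemma ge_pe_append: "awalk u p v \<Longrightarrow> awalk v q w \<Longrightarrow> ge u p * pe u (p @ q) = pe v q"
  by (simp add: pe_append ge_pe_same V_pe flip: mult.assoc)

lemma ge_append_pe: "awalk u p v \<Longrightarrow> awalk v q w \<Longrightarrow> ge u (p @ q) * pe u p = ge v q"
  by (simp add: ge_append ge_pe_same ge_V mult.assoc)

lemma ge_pe_diff: "awalk u p w \<Longrightarrow> awalk u' q t \<Longrightarrow> u \<noteq> u' \<Longrightarrow> ge u p * pe u' q = 0"
  using ge_V[of u p w] V_pe[of u' q t] V_mult[of u u']
  by (metis awalk_hd_in_verts mult.assoc mult_zero_left mult_zero_right)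

text \<open>Equal leading edges cancel by \<open>CK1\<close>; at the first place where the walks
  differ \<open>CK1\<close> gives zero.\<close>

lemma ge_pe_parallel:
  "awalk u p w \<Longrightarrow> awalk u q t \<Longrightarrow> parallel p q \<Longrightarrow> ge u p * pe u q = 0"
proof (induction p arbitrary: u q)
  case Nil then show ?case by simp
next
  case (Cons e p)
  then obtain f q' where q: "q = f # q'" by (cases q) auto
  have w: "e \<in> arcs E" "awalk (head E e) p w" "f \<in> arcs E" "awalk (head E f) q' t"
    using Cons.prems q by (auto simp: awalk_simps)
  have *: "ge u (e # p) * pe u q = ge (head E e) p * (star (Ed e) * Ed f) * pe (head E f) q'"
    by (simp add: ge_Cons q mult.assoc)
  show ?case
  proof (cases "e = f")
    case True
    then have "parallel p q'" using Cons.prems q by (auto simp: parallel_cancel)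
    then show ?thesis using * w Cons.IH[of "head E e" q'] True by (simp add: CK1 ge_V)
  next
    case False then show ?thesis using * w by (simp add: CK1)
  qed
qed

lemma prefix_or_parallel:
  obtains r where "q = p @ r" | r where "p = q @ r" | "parallel p q"
  by (metis parallelI prefix_def)

lemma cyl_Nil: "v \<in> verts E \<Longrightarrow> cyl v [] = V v"
  by (simp add: cyl_def ge_Nil V_mult)

lemma cyl_append: "awalk u p v \<Longrightarrow> awalk v q w \<Longrightarrow> cyl u (p @ q) = pe u p * cyl v q * ge u p"
  by (simp add: cyl_def pe_append ge_append mult.assoc)

lemma cyl_pe: "awalk u p v \<Longrightarrow> cyl u p * pe u p = pe u p"
  by (simp add: cyl_def mult.assoc ge_pe_same pe_V)
lemma ge_cyl: "awalk u p v \<Longrightarrow> ge u p * cyl u p = ge u p"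
  by (simp add: cyl_def ge_pe_same V_ge flip: mult.assoc)
lemma cyl_idem: "awalk u p v \<Longrightarrow> cyl u p * cyl u p = cyl u p"
  using cyl_pe[of u p v] by (simp add: cyl_def flip: mult.assoc)

lemma cyl_cyl_append:
  assumes "awalk u p v" "awalk v q w"
  shows "cyl u p * cyl u (p @ q) = cyl u (p @ q)" "cyl u (p @ q) * cyl u p = cyl u (p @ q)"
  using cyl_pe[OF assms(1)] ge_cyl[OF assms(1)]
  by (simp_all add: cyl_append[OF assms] mult.assoc) (simp add: flip: mult.assoc)

lemma cyl_mult_zero:
  assumes "awalk u p v" "awalk u' q w" "u \<noteq> u' \<or> parallel p q"
  shows "cyl u p * cyl u' q = 0"
proof -
  have "ge u p * pe u' q = 0" using assms ge_pe_diff ge_pe_parallel by blast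
  then have "pe u p * (ge u p * pe u' q) * ge u' q = 0" by simp
  then show ?thesis by (simp add: cyl_def mult.assoc)
qed

lemma cyl_split:
  assumes "regular_vertex E v" "awalk u p v"
  shows "cyl u p = (\<Sum>e\<in>out_arcs E v. cyl u (p @ [e]))"
proof -
  have "cyl u p = pe u p * V v * ge u p" using assms by (simp add: cyl_def pe_V)
  also have "\<dots> = (\<Sum>e\<in>out_arcs E v. pe u p * (Ed e * star (Ed e)) * ge u p)"
    by (simp add: CK2[OF assms(1)] sum_distrib_left sum_distrib_right)
  also have "\<dots> = (\<Sum>e\<in>out_arcs E v. cyl u (p @ [e]))"
  proof (intro sum.cong refl)
    fix e assume e: "e \<in> out_arcs E v"
    then have "cyl v [e] = Ed e * star (Ed e)"
      using Ed_head[of e] by (simp add: cyl_def ge_Cons ge_Nil flip: mult.assoc)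
    then show "pe u p * (Ed e * star (Ed e)) * ge u p = cyl u (p @ [e])"
      using cyl_append[OF assms(2) out_arcs_awalk[OF e]] by simp
  qed
  finally show ?thesis .
qed


section \<open>Spans and generated algebras\<close>

inductive_set span :: "'a set \<Rightarrow> 'a set" for X where
  span_zero: "0 \<in> span X"
| span_step: "x \<in> X \<Longrightarrow> y \<in> span X \<Longrightarrow> sc r x + y \<in> span X"

inductive_set alg :: "'a set \<Rightarrow> 'a set" for X where
  alg_zero: "0 \<in> alg X"
| alg_base: "x \<in> X \<Longrightarrow> x \<in> alg X"
| alg_add: "x \<in> alg X \<Longrightarrow> y \<in> alg X \<Longrightarrow> x + y \<in> alg X"
| alg_mult: "x \<in> alg X \<Longrightarrow> y \<in> alg X \<Longrightarrow> x * y \<in> alg X"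
| alg_sc: "x \<in> alg X \<Longrightarrow> sc r x \<in> alg X"

lemma alg_sum: "(\<And>i. i \<in> A \<Longrightarrow> f i \<in> alg X) \<Longrightarrow> sum f A \<in> alg X"
  by (induction A rule: infinite_finite_induct) (auto intro: alg.intros)

lemma alg_diff: "x \<in> alg X \<Longrightarrow> y \<in> alg X \<Longrightarrow> x - y \<in> alg X"
  using alg_add[OF _ alg_sc[of y X "- 1"], of x] by (simp add: sc_minus_one)

lemma alg_star:
  assumes "x \<in> alg X" "star ` X \<subseteq> X" shows "star x \<in> alg X"
  using assms(1) by (induction) (use assms(2) in \<open>auto simp: star_add star_mult star_sc intro: alg.intros\<close>)

lemma span_add: "x \<in> span X \<Longrightarrow> y \<in> span X \<Longrightarrow> x + y \<in> span X"
  by (induction rule: span.induct) (auto simp: add.assoc intro: span.intros)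

lemma span_base: "x \<in> X \<Longrightarrow> x \<in> span X"
  using span_step[of x X 0 1] span_zero by simp

lemma span_sc: "x \<in> span X \<Longrightarrow> sc r x \<in> span X"
  by (induction rule: span.induct) (auto simp: sc_add sc_sc intro: span.intros)

text \<open>Indexing by \<open>K\<close> collects repeated generators into one coefficient per
  index. Comparing coefficients in \<open>corner_coefficient_zero\<close> depends on this
  form.\<close>

lemma span_sum_form:
  assumes "y \<in> span (f ` I)"
  shows "\<exists>K a. finite K \<and> K \<subseteq> I \<and> y = (\<Sum>k\<in>K. sc (a k) (f k))"
  using assms
proof induction
  case span_zero then show ?case by (intro exI[of _ "{}"]) auto
next
  case (span_step x y r)
  then obtain K a i where K: "finite K" "K \<subseteq> I" "y = (\<Sum>k\<in>K. sc (a k) (f k))" "x = f i" "i \<in> I" by auto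
  \<comment> \<open>The old coefficients and the new one at \<open>i\<close>, both extended by zero;
    \<open>i\<close> may already lie in \<open>K\<close>.\<close>
  define b where "b = (\<lambda>k. (if k = i then r else 0) + (if k \<in> K then a k else 0))"
  have "(\<Sum>k\<in>insert i K. sc (b k) (f k)) = (\<Sum>k\<in>insert i K. sc (if k = i then r else 0) (f k))
      + (\<Sum>k\<in>insert i K. sc (if k \<in> K then a k else 0) (f k))"
    by (simp add: b_def sc_plus sum.distrib)
  also have "(\<Sum>k\<in>insert i K. sc (if k = i then r else 0) (f k)) = (\<Sum>k\<in>{i}. sc r (f k))"
    by (intro sum.mono_neutral_cong_right) (use K in auto)
  also have "(\<Sum>k\<in>insert i K. sc (if k \<in> K then a k else 0) (f k)) = y"
    unfolding K(3) by (intro sum.mono_neutral_cong_right) (use K in auto)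
  finally show ?case using K by (intro exI[of _ "insert i K"] exI[of _ b]) auto
qed

definition monomials :: "'a set" where
  "monomials = {pe u p * ge u' q | u p u' q w. awalk u p w \<and> awalk u' q w}"

text \<open>For \<open>m = pe u p * ge u' q\<close> with a common range the inner factors of
  \<open>m * star m\<close> and \<open>star m * m\<close> cancel, leaving \<open>cyl u p\<close> and
  \<open>cyl u' q\<close>. Normality of \<open>m\<close> is therefore the equation of
  cylinders.\<close>

definition normals :: "'a set" where
  "normals = {pe u p * ge u' q | u p u' q w. awalk u p w \<and> awalk u' q w \<and> cyl u p = cyl u' q}"

lemma cyl_normals: "awalk u p w \<Longrightarrow> cyl u p \<in> normals"
  unfolding normals_def cyl_def by blast

lemma star_normals: "star ` normals \<subseteq> normals"
  unfolding normals_def by (force simp: star_mult)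


section \<open>Vertices with a unique path of each length\<close>

text \<open>Equivalently, no vertex reachable from \<open>v\<close> emits two edges. Sinks are
  included.\<close>

definition rigid :: "'v \<Rightarrow> bool" where
  "rigid v \<longleftrightarrow> (\<forall>p q w t. awalk v p w \<longrightarrow> awalk v q t \<longrightarrow> length p = length q \<longrightarrow> p = q)"

lemma rigidD: "rigid v \<Longrightarrow> awalk v p w \<Longrightarrow> awalk v q t \<Longrightarrow> length p = length q \<Longrightarrow> p = q"
  unfolding rigid_def by blast

lemma rigid_awalk:
  assumes "rigid v" "awalk v p w" shows "rigid w"
  unfolding rigid_def
proof safe
  fix q r s t assume "awalk w q s" "awalk w r t" "length q = length r"
  then have "p @ q = p @ r"
    using assms by (intro rigidD[OF assms(1) awalk_append awalk_append]) auto
  then show "q = r" by simp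
qed

text \<open>Each vertex that the walk leaves emits exactly one edge, hence is regular, and
  \<open>CK2\<close> there has a single summand. The cylinder shrinks to the vertex edge by
  edge.\<close>

lemma rigid_cyl:
  "rigid v \<Longrightarrow> awalk v p w \<Longrightarrow> cyl v p = V v"
proof (induction p arbitrary: v)
  case Nil then show ?case by (auto simp: awalk_simps cyl_Nil)
next
  case (Cons e p)
  have e: "e \<in> arcs E" "tail E e = v" "awalk (head E e) p w" "awalk v [e] (head E e)"
    using Cons.prems by (auto simp: awalk_simps)
  have out: "out_arcs E v = {e}"
  proof -
    have "f = e" if "f \<in> out_arcs E v" for f
      using rigidD[OF Cons.prems(1) out_arcs_awalk[OF that] e(4)] by simp
    moreover have "e \<in> out_arcs E v" using e(1,2) by simp
    ultimately show ?thesis by blast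
  qed
  have v: "v \<in> verts E" using e(1,2) by auto
  then have reg: "regular_vertex E v" using out by (simp add: regular_vertex_def)
  have "cyl v (e # p) = pe v [e] * cyl (head E e) p * ge v [e]"
    using cyl_append[OF e(4,3)] by simp
  also have "cyl (head E e) p = V (head E e)"
    using Cons.IH[OF rigid_awalk[OF Cons.prems(1) e(4)] e(3)] .
  also have "pe v [e] * V (head E e) * ge v [e] = cyl v [e]"
    using pe_V[OF e(4)] by (simp add: cyl_def)
  also have "\<dots> = cyl v []"
    using cyl_split[OF reg, of v "[]"] out v by (simp add: awalk_simps)
  finally show ?case using v by (simp add: cyl_Nil)
qed

text \<open>Walks that stay prefixes after prepending \<open>k\<close> are prefixes of the periodic walk \<open>k k k \<dots>\<close>.\<close>

lemma prefix_shift_unique: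
  assumes "k \<noteq> []" "prefix p (k @ p)" "prefix q (k @ q)" "length p = length q"
  shows "p = q"
proof -
  have "take m p = take m q" if "m \<le> length p" for m
    using that
  proof (induction m rule: less_induct)
    case (less m)
    have p: "p = take (length p) (k @ p)" and q: "q = take (length p) (k @ q)"
      using assms(2-4) by (metis prefix_def append_eq_conv_conj)+
    have "take m p = take m (k @ p)"
      by (subst p) (use less.prems in \<open>simp add: min_def\<close>)
    also have "\<dots> = take m (k @ q)"
      using less.IH[of "m - length k"] less.prems assms(1) by (cases "m = 0") auto
    also have "\<dots> = take m q"
      by (subst (2) q) (use less.prems in \<open>simp add: min_def\<close>)
    finally show ?case .
  qed
  from this[of "length p"] show ?thesis using assms(4) by simp
qed

text \<open>All walks from \<open>v\<close> follow the same periodic walk. This is how a closed path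
  \<open>k\<close> forces rigidity, both when its coefficient survives and when its cylinder is the
  whole vertex.\<close>

lemma rigidI_prefix:
  assumes "k \<noteq> []" "\<And>p w. awalk v p w \<Longrightarrow> prefix p (k @ p)"
  shows "rigid v"
  unfolding rigid_def using prefix_shift_unique[OF assms(1)] assms(2) by blast


section \<open>The centralizer of the diagonal lies in the commutative core\<close>

text \<open>For a finite set \<open>A\<close> of edges leaving \<open>v\<close>, this kills the
  walks that start with an edge of \<open>A\<close> and fixes all other nonempty walks from
  \<open>v\<close>. Conjugated by a path it removes from a cylinder the subcylinders given by
  \<open>A\<close>.\<close>

definition cutoff :: "'v \<Rightarrow> 'e set \<Rightarrow> 'a" where
  "cutoff v A = V v - (\<Sum>e\<in>A. Ed e * star (Ed e))"

lemma pe_edge: "e \<in> arcs E \<Longrightarrow> pe v [e] = Ed e"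
  by (simp add: Ed_head)

lemma cyl_edge: "e \<in> arcs E \<Longrightarrow> cyl v [e] = Ed e * star (Ed e)"
  by (simp only: cyl_def pe_edge ge_def)

lemma pe_cutoff_ge:
  assumes "awalk u p v" "A \<subseteq> out_arcs E v"
  shows "pe u p * cutoff v A * ge u p = cyl u p - (\<Sum>e\<in>A. cyl u (p @ [e]))"
proof -
  have "pe u p * (\<Sum>e\<in>A. Ed e * star (Ed e)) * ge u p = (\<Sum>e\<in>A. cyl u (p @ [e]))"
    unfolding sum_distrib_left sum_distrib_right
  proof (intro sum.cong refl)
    fix e assume "e \<in> A"
    then have e: "e \<in> out_arcs E v" using assms by auto
    show "pe u p * (Ed e * star (Ed e)) * ge u p = cyl u (p @ [e])"
      using cyl_append[OF assms(1) out_arcs_awalk[OF e]] e by (simp only: cyl_edge in_out_arcs_conv)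
  qed
  then show ?thesis
    by (simp add: cutoff_def left_diff_distrib right_diff_distrib pe_V[OF assms(1)] cyl_def)
qed

lemma cutoff_pe:
  assumes "finite A" "A \<subseteq> out_arcs E v" "awalk v (f # p) w"
  shows "cutoff v A * pe v (f # p) = (if f \<in> A then 0 else pe v (f # p))"
proof -
  have f: "f \<in> arcs E" "awalk v [f] (head E f)" "awalk (head E f) p w"
    using assms(3) by (auto simp: awalk_simps)
  have "(\<Sum>e\<in>A. Ed e * star (Ed e)) * pe v (f # p)
      = (\<Sum>e\<in>A. Ed e * (star (Ed e) * Ed f) * pe (head E f) p)"
    by (simp add: sum_distrib_right mult.assoc)
  also have "\<dots> = (\<Sum>e\<in>A. if e = f then pe v (f # p) else 0)"
    by (intro sum.cong refl) (use assms f in \<open>auto simp: CK1 Ed_head\<close>)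
  also have "\<dots> = (if f \<in> A then pe v (f # p) else 0)"
    using assms(1) by simp
  finally show ?thesis using V_pe[OF assms(3)] by (simp add: cutoff_def left_diff_distrib)
qed

lemma star_sum: "star (sum f A) = (\<Sum>i\<in>A. star (f i))"
  by (induction A rule: infinite_finite_induct) (auto simp: star_add)

lemma star_uminus: "star (- x) = - star x"
  using star_add[of x "- x"] by (simp add: eq_neg_iff_add_eq_0 add.commute)

lemma star_diff: "star (x - y) = star x - star y"
  using star_add[of x "- y"] by (simp add: star_uminus)

lemma star_cutoff: "v \<in> verts E \<Longrightarrow> star (cutoff v A) = cutoff v A"
  by (simp add: cutoff_def star_diff star_sum star_V star_mult)

lemma ge_cutoff:
  assumes "finite A" "A \<subseteq> out_arcs E v" "awalk v (f # p) w"
  shows "ge v (f # p) * cutoff v A = (if f \<in> A then 0 else ge v (f # p))"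
  using arg_cong[OF cutoff_pe[OF assms], of star] awalk_hd_in_verts[OF assms(3)]
  by (simp add: star_mult star_cutoff split: if_splits del: pe.simps)

text \<open>For \<open>\<delta> = f # d\<close> the product \<open>ge u (b @ k @ \<delta>) * x * pe u (b @ \<delta>)\<close> isolates the
  coefficient \<open>a k\<close>; it is zero because \<open>x\<close> commutes with \<open>cyl u (b @ \<delta>)\<close>.\<close>

lemma corner_coefficient_zero:
  assumes comm: "\<And>u p w. awalk u p w \<Longrightarrow> x * cyl u p = cyl u p * x"
    and b: "awalk u b v" and A: "finite A" "A \<subseteq> out_arcs E v"
    and K: "finite K" "\<And>k. k \<in> K \<Longrightarrow> awalk v k v \<and> length k = n"
    and eq: "ge u b * x * pe u b * cutoff v A = (\<Sum>k\<in>K. sc (a k) (pe v k * cutoff v A))"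
    and k: "k \<in> K" and d: "awalk v (f # d) w" "f \<notin> A" "\<not> prefix (f # d) (k @ f # d)"
    and n: "n > 0"
  shows "a k = 0"
proof -
  let ?d = "f # d"
  have kd: "awalk v (k @ ?d) w" using K(2)[OF k] d by (auto intro: awalk_append)
  have "\<not> prefix (k @ ?d) ?d"
    using K(2)[OF k] n by (auto dest: prefix_length_le)
  then have par: "parallel (k @ ?d) ?d" using d by auto
  have "ge v (k @ ?d) * (ge u b * x * pe u b * cutoff v A) * pe v ?d
      = (ge v (k @ ?d) * ge u b) * x * (pe u b * (cutoff v A * pe v ?d))"
    by (simp only: mult.assoc)
  also have "\<dots> = ge u (b @ k @ ?d) * x * pe u (b @ ?d)"
    using cutoff_pe[OF A d(1)] d by (simp only: ge_append[OF b kd] pe_append[OF b d(1)] if_False)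
  \<comment> \<open>The cylinder of \<open>b @ ?d\<close> fixes the path on its right. Moved across
    \<open>x\<close>, it meets the ghost path of \<open>b @ k @ ?d\<close>, which is parallel to it,
    so the whole product vanishes.\<close>
  also have "\<dots> = ge u (b @ k @ ?d) * (x * cyl u (b @ ?d)) * pe u (b @ ?d)"
    using cyl_pe[OF awalk_append[OF b d(1)]] by (simp only: mult.assoc)
  also have "\<dots> = ge u (b @ k @ ?d) * (cyl u (b @ ?d) * x) * pe u (b @ ?d)"
    by (simp only: comm[OF awalk_append[OF b d(1)]])
  also have "\<dots> = (ge u (b @ k @ ?d) * pe u (b @ ?d)) * ge u (b @ ?d) * x * pe u (b @ ?d)"
    by (simp only: cyl_def mult.assoc)
  also have "ge u (b @ k @ ?d) * pe u (b @ ?d) = 0"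
    using par by (intro ge_pe_parallel[OF awalk_append[OF b kd] awalk_append[OF b d(1)]])
      (auto simp: parallel_def)
  finally have "0 = (\<Sum>j\<in>K. ge v (k @ ?d) * sc (a j) (pe v j * cutoff v A) * pe v ?d)"
    unfolding eq by (simp only: sum_distrib_left sum_distrib_right mult_zero_left)
  also have "\<dots> = (\<Sum>j\<in>K. sc (a j) (ge v (k @ ?d) * pe v (j @ ?d)))"
  proof (intro sum.cong refl)
    fix j assume j: "j \<in> K"
    have "pe v (j @ ?d) = pe v j * (cutoff v A * pe v ?d)"
      using cutoff_pe[OF A d(1)] d(2) K(2)[OF j] d(1) by (simp only: pe_append[of v j v ?d w] if_False)
    then show "ge v (k @ ?d) * sc (a j) (pe v j * cutoff v A) * pe v ?d = sc (a j) (ge v (k @ ?d) * pe v (j @ ?d))"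
      by (simp only: sc_mult_left sc_mult_right mult.assoc)
  qed
  \<comment> \<open>All members of \<open>K\<close> have length \<open>n\<close>, so distinct ones
    diverge and only the summand at \<open>k\<close> survives.\<close>
  also have "\<dots> = (\<Sum>j\<in>K. if j = k then sc (a k) (V w) else 0)"
  proof (intro sum.cong refl)
    fix j assume j: "j \<in> K"
    have jd: "awalk v (j @ ?d) w" using K(2)[OF j] d by (auto intro: awalk_append)
    show "sc (a j) (ge v (k @ ?d) * pe v (j @ ?d)) = (if j = k then sc (a k) (V w) else 0)"
    proof (cases "j = k")
      case True then show ?thesis using ge_pe_same[OF kd] by simp
    next
      case False
      then have "parallel (k @ ?d) (j @ ?d)"
        using K(2)[OF j] K(2)[OF k] by (intro not_equal_is_parallel) auto
      then show ?thesis using ge_pe_parallel[OF kd jd] False by simp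
    qed
  qed
  also have "\<dots> = sc (a k) (V w)" using K(1) k by simp
  finally show ?thesis using torsion_free[of w "a k"] d(1) by (simp add: awalk_last_in_verts)
qed

text \<open>Commutation with \<open>cyl u b\<close> turns \<open>x\<close> times the cut cylinder
  into a conjugate of the corner of \<open>x\<close>. Every summand of that conjugate is a normal
  monomial, a multiple of the cut cylinder, or zero.\<close>

lemma corner_in_core:
  assumes comm: "\<And>u p w. awalk u p w \<Longrightarrow> x * cyl u p = cyl u p * x"
    and b: "awalk u b v" and A: "finite A" "A \<subseteq> out_arcs E v"
    and span: "ge u b * x * pe u b * cutoff v A \<in> span ((\<lambda>k. pe v k * cutoff v A) ` {k. awalk v k v \<and> length k = n})"
  shows "x * (pe u b * cutoff v A * ge u b) \<in> alg normals"
proof -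
  obtain K a where K: "finite K" "K \<subseteq> {k. awalk v k v \<and> length k = n}"
    and eq: "ge u b * x * pe u b * cutoff v A = (\<Sum>k\<in>K. sc (a k) (pe v k * cutoff v A))"
    using span_sum_form[OF span] by blast
  have v: "v \<in> verts E" using b by (rule awalk_last_in_verts)
  have cut: "pe u b * cutoff v A * ge u b \<in> alg normals"
    unfolding pe_cutoff_ge[OF b A(2)]
  proof (intro alg_diff alg_sum alg_base)
    show "cyl u b \<in> normals" using cyl_normals b .
    show "cyl u (b @ [e]) \<in> normals" if "e \<in> A" for e
      using cyl_normals[OF awalk_append[OF b out_arcs_awalk]] that A by blast
  qed
  have "cyl u b * (pe u b * cutoff v A * ge u b) = pe u b * cutoff v A * ge u b"
    using cyl_pe[OF b] by (simp flip: mult.assoc)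
  then have "x * (pe u b * cutoff v A * ge u b) = x * cyl u b * (pe u b * cutoff v A * ge u b)"
    by (simp add: mult.assoc)
  also have "\<dots> = cyl u b * x * (pe u b * cutoff v A * ge u b)" using comm[OF b] by simp
  also have "\<dots> = pe u b * (ge u b * x * pe u b * cutoff v A) * ge u b"
    by (simp add: cyl_def mult.assoc)
  also have "\<dots> = (\<Sum>k\<in>K. sc (a k) (pe u b * (pe v k * cutoff v A) * ge u b))"
    unfolding eq by (simp add: sum_distrib_left sum_distrib_right sc_mult_left sc_mult_right)
  also have "\<dots> \<in> alg normals"
  proof (intro alg_sum)
    fix k assume k: "k \<in> K"
    then have kw: "awalk v k v" "length k = n" using K by auto
    \<comment> \<open>The cases in turn: \<open>k\<close> is trivial; \<open>A\<close> contains all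
      edges leaving \<open>v\<close> and \<open>CK2\<close> makes the cutoff zero; \<open>v\<close>
      is rigid, so \<open>A\<close> is empty and the summand is a multiple of a normal monomial;
      \<open>v\<close> is not rigid and the coefficient must vanish.\<close>
    consider (zero) "n = 0" | (full) "out_arcs E v \<subseteq> A" "n > 0"
      | (rigid) f where "rigid v" "f \<in> out_arcs E v" "f \<notin> A" "n > 0"
      | (exit) f where "\<not> rigid v" "f \<in> out_arcs E v" "f \<notin> A" "n > 0" by blast
    then show "sc (a k) (pe u b * (pe v k * cutoff v A) * ge u b) \<in> alg normals"
    proof cases
      case zero
      then have "k = []" using kw by simp
      moreover have "pe u b * (V v * cutoff v A) * ge u b = pe u b * cutoff v A * ge u b"
        using pe_V[OF b] by (simp flip: mult.assoc)
      ultimately show ?thesis using cut by (simp add: alg_sc)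
    next
      case full
      then have "A = out_arcs E v" using A by auto
      moreover have "out_arcs E v \<noteq> {}" using kw full(2) by (cases k) (auto simp: awalk_simps)
      ultimately have "cutoff v A = 0"
        using CK2[of v] A v by (simp add: cutoff_def regular_vertex_def)
      then show ?thesis by (simp add: alg_zero)
    next
      case rigid
      have "A = {}"
        using rigidD[OF rigid(1) out_arcs_awalk out_arcs_awalk] rigid(2,3) A(2) by fastforce
      then have "pe u b * (pe v k * cutoff v A) * ge u b = pe u (b @ k) * ge u b"
        using pe_V[OF kw(1)] pe_append[OF b kw(1)] by (simp add: cutoff_def)
      moreover have "cyl u (b @ k) = cyl u b"
        using cyl_append[OF b kw(1)] rigid_cyl[OF rigid(1) kw(1)] pe_V[OF b] by (simp add: cyl_def)
      then have "pe u (b @ k) * ge u b \<in> normals"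
        unfolding normals_def using b awalk_append[OF b kw(1)] by blast
      ultimately show ?thesis by (simp add: alg.intros)
    next
      case exit
      have "a k = 0"
      proof (rule ccontr)
        assume "a k \<noteq> 0"
        have pre: "prefix (g # d) (k @ g # d)" if "awalk v (g # d) w" "g \<notin> A" for g d w
        proof (rule ccontr)
          assume np: "\<not> prefix (g # d) (k @ g # d)"
          have "a k = 0"
            by (rule corner_coefficient_zero[OF _ b A K(1) _ eq k that np]) (use comm K(2) exit in auto)
          then show False using \<open>a k \<noteq> 0\<close> by simp
        qed
        have k0: "k \<noteq> []" using kw exit by auto
        have "prefix [f] (k @ [f])" using pre out_arcs_awalk[OF exit(2)] exit by blast
        then obtain k' where k': "k = f # k'" using k0 by (cases k) auto
        \<comment> \<open>Since \<open>k\<close> starts with \<open>f\<close>, which is not in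
          \<open>A\<close>, \<open>pre\<close> applies to \<open>k @ d\<close> for every walk
          \<open>d\<close>, whatever its first edge. Cancelling \<open>k\<close> gives the claim,
          and rigidity of \<open>v\<close> follows.\<close>
        have "prefix d (k @ d)" if d: "awalk v d w" for d w
          using pre[of f "k' @ d" w] awalk_append[OF kw(1) d] exit(3) by (simp add: k')
        then show False using rigidI_prefix[OF k0] exit(1) by blast
      qed
      then show ?thesis by (simp add: alg_zero)
    qed
  qed
  finally show ?thesis .
qed

section \<open>Corners of homogeneous elements\<close>

definition hmonomials :: "int \<Rightarrow> 'a set" where
  "hmonomials n = {pe u p * ge u' q | u p u' q w.
     awalk u p w \<and> awalk u' q w \<and> int (length p) = int (length q) + n}"

abbreviation corner_span :: "nat \<Rightarrow> 'v \<Rightarrow> 'e set \<Rightarrow> 'a set" where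
  "corner_span n v A \<equiv> span ((\<lambda>k. pe v k * cutoff v A) ` {k. awalk v k v \<and> length k = n})"

lemma awalk_appendD: "awalk u p v \<Longrightarrow> awalk u (p @ q) w \<Longrightarrow> awalk v q w"
  by (metis awalk_appendE awalk_fun)

text \<open>Compare \<open>b\<close> with the ghost part \<open>q\<close>. If \<open>b\<close>
  extends \<open>q\<close>, a path remains that is closed at \<open>v\<close> and has length
  \<open>n\<close>, or the product is zero. If \<open>q\<close> properly extends \<open>b\<close>,
  its next edge lies in \<open>A\<close> by \<open>small\<close> and the cutoff kills it. If they
  diverge, the product is zero.\<close>

lemma corner_monomial:
  assumes p: "awalk s p w" and q: "awalk t q w" and len: "length p = length q + n"
    and b: "awalk u b v" and A: "finite A" "A \<subseteq> out_arcs E v"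
    and small: "length b \<le> length q \<Longrightarrow> set q \<inter> out_arcs E v \<subseteq> A"
  shows "ge u b * (pe s p * ge t q) * pe u b * cutoff v A \<in> corner_span n v A"
proof (cases "t = u")
  case False
  then have "ge u b * pe s p * (ge t q * pe u b) * cutoff v A = 0" using ge_pe_diff[OF q b] by simp
  then show ?thesis by (simp add: mult.assoc span_zero)
next
  case t: True
  have extend: ?thesis if r: "b = q @ r" for r
  proof -
    have wr: "awalk w r v" using b q t unfolding r by (blast intro: awalk_appendD)
    have sr: "awalk s (p @ r) v" using awalk_append[OF p wr] .
    have "ge u b * (pe s p * ge t q) * pe u b * cutoff v A = ge u b * (pe s p * (ge t q * pe t (q @ r))) * cutoff v A"
      by (simp only: mult.assoc r t)
    also have "\<dots> = ge u b * pe s (p @ r) * cutoff v A"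
      by (simp only: ge_pe_append[OF q wr] pe_append[OF p wr])
    also have "\<dots> \<in> corner_span n v A"
    proof (cases "s = u")
      case False
      then show ?thesis using ge_pe_diff[OF b sr] by (simp add: span_zero)
    next
      case s: True
      show ?thesis
      proof (cases "parallel b (p @ r)")
        case True
        then show ?thesis using ge_pe_parallel[OF b, of "p @ r" v] sr s by (simp add: span_zero)
      next
        case False
        then have "prefix b (p @ r)"
          using prefix_length_prefix[of b b "p @ r"] len r by (auto simp: parallel_def)
        then obtain k where k: "p @ r = b @ k" by (auto simp: prefix_def)
        have "awalk v k v" using sr b unfolding k s by (blast intro: awalk_appendD)
        moreover have "length k = n" using arg_cong[OF k, of length] len r by simp
        moreover have "ge u b * pe s (p @ r) = pe v k"
          unfolding k s using ge_pe_append[OF b] \<open>awalk v k v\<close> by simp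
        ultimately show ?thesis by (auto intro!: span_base)
      qed
    qed
    finally show ?thesis .
  qed
  consider (ext) r where "b = q @ r" | (long) f r where "q = b @ f # r" | (par) "parallel q b"
    by (metis neq_Nil_conv prefix_or_parallel append_Nil2)
  then show ?thesis
  proof cases
    case ext then show ?thesis by (rule extend)
  next
    case par
    then have "ge t q * pe u b = 0" using ge_pe_parallel[OF q, of b v] b t by simp
    then have "ge u b * pe s p * (ge t q * pe u b) * cutoff v A = 0" by simp
    then show ?thesis by (simp add: mult.assoc span_zero)
  next
    case long
    have fr: "awalk v (f # r) w" using q b unfolding long t by (blast intro: awalk_appendD)
    have "f \<in> A" using small awalk_out_arcs[OF fr] long by auto
    have "ge u b * (pe s p * ge t q) * pe u b * cutoff v A
        = ge u b * pe s p * (ge u (b @ f # r) * pe u b * cutoff v A)"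
      by (simp only: mult.assoc long t)
    also have "ge u (b @ f # r) * pe u b = ge v (f # r)" using ge_append_pe[OF b fr] .
    also have "ge v (f # r) * cutoff v A = 0" using ge_cutoff[OF A fr] \<open>f \<in> A\<close> by simp
    finally show ?thesis by (simp add: span_zero)
  qed
qed

text \<open>\<open>N\<close> bounds the lengths of the ghost parts of the monomials of
  \<open>x\<close>, and \<open>B\<close> collects their edges. Both depend on \<open>x\<close>
  alone; beyond length \<open>N\<close> even \<open>A = {}\<close> is allowed.\<close>

lemma corner_in_span:
  assumes "x \<in> span (hmonomials (int n))"
  shows "\<exists>N B. finite B \<and> (\<forall>u b v A. awalk u b v \<longrightarrow> finite A \<longrightarrow> A \<subseteq> out_arcs E v
     \<longrightarrow> (length b \<le> N \<longrightarrow> B \<inter> out_arcs E v \<subseteq> A)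
     \<longrightarrow> ge u b * x * pe u b * cutoff v A \<in> corner_span n v A)"
  using assms
proof induction
  case span_zero
  show ?case by (rule exI[of _ 0], rule exI[of _ "{}"]) (simp add: span.span_zero)
next
  case (span_step m y r)
  from span_step.IH obtain N B where NB: "finite B" "\<forall>u b v A. awalk u b v \<longrightarrow> finite A \<longrightarrow> A \<subseteq> out_arcs E v
     \<longrightarrow> (length b \<le> N \<longrightarrow> B \<inter> out_arcs E v \<subseteq> A)
     \<longrightarrow> ge u b * y * pe u b * cutoff v A \<in> corner_span n v A" by (elim exE conjE)
  from span_step(1) obtain s p t q w where m: "m = pe s p * ge t q" "awalk s p w" "awalk t q w"
    "length p = length q + n" unfolding hmonomials_def by force
  show ?case
  proof (rule exI[of _ "max N (length q)"], rule exI[of _ "B \<union> set q"], intro conjI allI impI)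
    show "finite (B \<union> set q)" using NB by simp
    fix u b v A
    assume a: "awalk u b v" "finite A" "A \<subseteq> out_arcs E v"
      and l: "length b \<le> max N (length q) \<longrightarrow> (B \<union> set q) \<inter> out_arcs E v \<subseteq> A"
    have "ge u b * (sc r m + y) * pe u b * cutoff v A
        = sc r (ge u b * m * pe u b * cutoff v A) + ge u b * y * pe u b * cutoff v A"
      by (simp add: distrib_left distrib_right sc_mult_left sc_mult_right)
    moreover have "ge u b * m * pe u b * cutoff v A \<in> corner_span n v A"
      unfolding m(1) by (rule corner_monomial[OF m(2-4) a]) (use l in auto)
    moreover have "ge u b * y * pe u b * cutoff v A \<in> corner_span n v A"
      by (rule NB(2)[rule_format, OF a]) (use l in auto)
    ultimately show "ge u b * (sc r m + y) * pe u b * cutoff v A \<in> corner_span n v A"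
      by (simp add: span_add span_sc)
  qed
qed

text \<open>A substitute for a unit: the sources of the ghost parts suffice. Allowing every larger
  finite \<open>W'\<close> lets the statement pass to sums.\<close>

lemma local_unit:
  assumes "x \<in> span (hmonomials n)"
  shows "\<exists>W. finite W \<and> W \<subseteq> verts E \<and> (\<forall>W'. finite W' \<longrightarrow> W \<subseteq> W' \<longrightarrow> W' \<subseteq> verts E \<longrightarrow> x = (\<Sum>v\<in>W'. x * V v))"
  using assms
proof induction
  case span_zero show ?case by (intro exI[of _ "{}"]) auto
next
  case (span_step m y r)
  from span_step.IH obtain W where W: "finite W" "W \<subseteq> verts E"
    "\<forall>W'. finite W' \<longrightarrow> W \<subseteq> W' \<longrightarrow> W' \<subseteq> verts E \<longrightarrow> y = (\<Sum>v\<in>W'. y * V v)" by (elim exE conjE)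
  from span_step(1) obtain s p t q w where m: "m = pe s p * ge t q" "awalk t q w"
    unfolding hmonomials_def by force
  have t: "t \<in> verts E" using m(2) by (rule awalk_hd_in_verts)
  show ?case
  proof (intro exI[of _ "insert t W"] conjI allI impI)
    fix W' assume W': "finite W'" "insert t W \<subseteq> W'" "W' \<subseteq> verts E"
    have "(\<Sum>v\<in>W'. m * V v) = (\<Sum>v\<in>W'. if v = t then m else 0)"
    proof (intro sum.cong refl)
      fix v assume "v \<in> W'"
      then have v: "v \<in> verts E" using W' by auto
      have "m * V v = pe s p * (ge t q * (V t * V v))" using ge_V[OF m(2)] m(1) by (simp flip: mult.assoc)
      then show "m * V v = (if v = t then m else 0)"
        using ge_V[OF m(2)] m(1) V_mult[OF t v] by auto
    qed
    then have "(\<Sum>v\<in>W'. m * V v) = m" using W' by simp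
    moreover have "y = (\<Sum>v\<in>W'. y * V v)" using W' by (intro W(3)[rule_format]) auto
    ultimately have "sc r m + y = sc r (\<Sum>v\<in>W'. m * V v) + (\<Sum>v\<in>W'. y * V v)" by simp
    also have "\<dots> = (\<Sum>v\<in>W'. (sc r m + y) * V v)"
      by (simp add: sc_sum sc_mult_left sum.distrib distrib_right)
    finally show "sc r m + y = (\<Sum>v\<in>W'. (sc r m + y) * V v)" .
  qed (use W t in auto)
qed

lemma homogeneous_in_core:
  assumes x: "x \<in> span (hmonomials (int n))"
    and comm: "\<And>u p w. awalk u p w \<Longrightarrow> x * cyl u p = cyl u p * x"
  shows "x \<in> alg normals"
proof -
  from corner_in_span[OF x] obtain N B where B: "finite B"
    and NB: "\<forall>u b v A. awalk u b v \<longrightarrow> finite A \<longrightarrow> A \<subseteq> out_arcs E v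
     \<longrightarrow> (length b \<le> N \<longrightarrow> B \<inter> out_arcs E v \<subseteq> A)
     \<longrightarrow> ge u b * x * pe u b * cutoff v A \<in> corner_span n v A" by (elim exE conjE)
  have cyl: "x * cyl u b \<in> alg normals" if "awalk u b v" for u b v
    using that
  \<comment> \<open>Downward induction on the length. \<open>Suc N\<close> makes the measure drop
    even from length \<open>N\<close>; for longer \<open>b\<close> the set \<open>A\<close> is empty
    and the recursion stops.\<close>
  proof (induction "Suc N - length b" arbitrary: b v rule: less_induct)
    case less
    define A where "A = (if length b \<le> N then B \<inter> out_arcs E v else {})"
    have A: "finite A" "A \<subseteq> out_arcs E v" using B by (auto simp: A_def)
    have "ge u b * x * pe u b * cutoff v A \<in> corner_span n v A"
      by (rule NB[rule_format, OF less.prems A]) (auto simp: A_def)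
    then have "x * (pe u b * cutoff v A * ge u b) \<in> alg normals"
      using corner_in_core[OF _ less.prems A] comm by blast
    moreover have "(\<Sum>e\<in>A. x * cyl u (b @ [e])) \<in> alg normals"
    proof (rule alg_sum)
      fix e assume e: "e \<in> A"
      then have "length b \<le> N" by (auto simp: A_def split: if_splits)
      then show "x * cyl u (b @ [e]) \<in> alg normals"
        using e A by (intro less.hyps[OF _ awalk_append[OF less.prems out_arcs_awalk]]) auto
    qed
    ultimately have "x * (pe u b * cutoff v A * ge u b) + (\<Sum>e\<in>A. x * cyl u (b @ [e])) \<in> alg normals"
      by (rule alg_add)
    then show ?case
      unfolding pe_cutoff_ge[OF less.prems A(2)] by (simp add: right_diff_distrib sum_distrib_left)
  qed
  obtain W where W: "finite W" "W \<subseteq> verts E" "x = (\<Sum>v\<in>W. x * V v)"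
    using local_unit[OF x] by blast
  have "(\<Sum>v\<in>W. x * V v) \<in> alg normals"
  proof (rule alg_sum)
    fix v assume "v \<in> W"
    then have v: "v \<in> verts E" using W by auto
    then show "x * V v \<in> alg normals" using cyl[of v "[]" v] by (simp add: awalk_Nil_iff cyl_Nil)
  qed
  then show ?thesis using W(3) by simp
qed

section \<open>Homogeneous components\<close>

lemma deg_pe_left: "awalk u p w \<Longrightarrow> deg n (pe u p * x) = pe u p * deg (n - int (length p)) x"
  by (induction p arbitrary: u n) (auto simp: awalk_simps deg_V_left deg_Ed_left mult.assoc algebra_simps)

lemma deg_pe_right: "awalk u p w \<Longrightarrow> deg n (x * pe u p) = deg (n - int (length p)) x * pe u p"
proof (induction p arbitrary: u n x)
  case Nil then show ?case by (auto simp: awalk_simps deg_V_right)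
next
  case (Cons e p)
  then have e: "e \<in> arcs E" "awalk (head E e) p w" by (auto simp: awalk_simps)
  have "deg n (x * Ed e * pe (head E e) p) = deg (n - int (length p) - 1) x * Ed e * pe (head E e) p"
    by (simp only: Cons.IH[OF e(2)] deg_Ed_right[OF e(1)])
  then show ?case by (simp add: mult.assoc algebra_simps)
qed

lemma deg_ge_left: "awalk u p w \<Longrightarrow> deg n (ge u p * x) = ge u p * deg (n + int (length p)) x"
proof (induction p arbitrary: u n x)
  case Nil then show ?case by (auto simp: awalk_simps deg_V_left ge_Nil)
next
  case (Cons e p)
  then have e: "e \<in> arcs E" "awalk (head E e) p w" by (auto simp: awalk_simps)
  have "deg n (ge (head E e) p * (star (Ed e) * x)) = ge (head E e) p * (star (Ed e) * deg (n + int (length p) + 1) x)"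
    by (simp only: Cons.IH[OF e(2)] deg_star_Ed_left[OF e(1)])
  then show ?case by (simp add: ge_Cons mult.assoc algebra_simps)
qed

lemma deg_ge_right: "awalk u p w \<Longrightarrow> deg n (x * ge u p) = deg (n + int (length p)) x * ge u p"
proof (induction p arbitrary: u n x)
  case Nil then show ?case by (auto simp: awalk_simps deg_V_right ge_Nil)
next
  case (Cons e p)
  then have e: "e \<in> arcs E" "awalk (head E e) p w" by (auto simp: awalk_simps)
  have "deg n (x * ge (head E e) p * star (Ed e)) = deg (n + 1 + int (length p)) x * ge (head E e) p * star (Ed e)"
    by (simp only: Cons.IH[OF e(2)] deg_star_Ed_right[OF e(1)])
  then show ?case by (simp add: ge_Cons mult.assoc algebra_simps)
qed

lemma deg_cyl_left: "awalk u p w \<Longrightarrow> deg n (cyl u p * x) = cyl u p * deg n x"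
  by (simp add: cyl_def mult.assoc deg_pe_left deg_ge_left)

lemma deg_cyl_right: "awalk u p w \<Longrightarrow> deg n (x * cyl u p) = deg n x * cyl u p"
  by (simp add: cyl_def deg_pe_right deg_ge_right flip: mult.assoc)

lemma deg_monomial:
  assumes "awalk u p w" "awalk u' q w"
  shows "deg n (pe u p * ge u' q) = (if int (length p) = int (length q) + n then pe u p * ge u' q else 0)"
proof -
  \<comment> \<open>The vertex is appended so that, after both walks have shifted the degree,
    \<open>deg_V\<close> decides the remaining factor.\<close>
  have "deg n (pe u p * (ge u' q * V u')) = pe u p * (ge u' q * deg (n - int (length p) + int (length q)) (V u'))"
    by (simp add: deg_pe_left[OF assms(1)] deg_ge_left[OF assms(2)])
  then show ?thesis using deg_V[OF awalk_hd_in_verts[OF assms(2)]] ge_V[OF assms(2)] by auto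
qed

lemma deg_span:
  assumes "x \<in> span monomials" shows "deg n x \<in> span (hmonomials n)"
  using assms
proof induction
  case span_zero then show ?case by (simp add: span.span_zero)
next
  case (span_step m y r)
  then obtain s p t q w where m: "m = pe s p * ge t q" "awalk s p w" "awalk t q w"
    unfolding monomials_def by blast
  have "pe s p * ge t q \<in> hmonomials n" if "int (length p) = int (length q) + n"
    using m(2,3) that unfolding hmonomials_def by blast
  then have "deg n m \<in> span (hmonomials n)"
    unfolding m(1) deg_monomial[OF m(2,3)] by (simp add: span_base span.span_zero)
  then show ?case using span_step by (simp add: deg_add deg_sc span_add span_sc)
qed

lemma deg_decomp:
  assumes "x \<in> span monomials"
  shows "\<exists>F. finite F \<and> (\<forall>F'. finite F' \<longrightarrow> F \<subseteq> F' \<longrightarrow> x = (\<Sum>n\<in>F'. deg n x))"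
  using assms
proof induction
  case span_zero show ?case by auto
next
  case (span_step m y r)
  from span_step.IH obtain F where F: "finite F" "\<forall>F'. finite F' \<longrightarrow> F \<subseteq> F' \<longrightarrow> y = (\<Sum>n\<in>F'. deg n y)"
    by (elim exE conjE)
  obtain s p t q w where m: "m = pe s p * ge t q" "awalk s p w" "awalk t q w"
    using span_step(1) unfolding monomials_def by blast
  define d where "d = int (length p) - int (length q)"
  show ?case
  proof (intro exI[of _ "insert d F"] conjI allI impI)
    fix F' assume F': "finite F'" "insert d F \<subseteq> F'"
    have "(\<Sum>n\<in>F'. deg n m) = (\<Sum>n\<in>F'. if n = d then m else 0)"
      by (intro sum.cong) (auto simp: m(1) deg_monomial[OF m(2,3)] d_def)
    then have "m = (\<Sum>n\<in>F'. deg n m)" using F' by simp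
    moreover have "y = (\<Sum>n\<in>F'. deg n y)" using F' by (intro F(2)[rule_format]) auto
    ultimately have "sc r m + y = sc r (\<Sum>n\<in>F'. deg n m) + (\<Sum>n\<in>F'. deg n y)" by simp
    also have "\<dots> = (\<Sum>n\<in>F'. deg n (sc r m + y))"
      by (simp add: deg_add deg_sc sc_sum sum.distrib)
    finally show "sc r m + y = (\<Sum>n\<in>F'. deg n (sc r m + y))" .
  qed (use F in auto)
qed

lemma star_hmonomials: "x \<in> span (hmonomials n) \<Longrightarrow> star x \<in> span (hmonomials (- n))"
proof (induction rule: span.induct)
  case span_zero then show ?case by (simp add: span.span_zero)
next
  case (span_step m y r)
  from span_step(1) obtain s p t q w where m: "m = pe s p * ge t q" "awalk s p w" "awalk t q w"
    "int (length p) = int (length q) + n" unfolding hmonomials_def by blast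
  then have "star m = pe t q * ge s p" "int (length q) = int (length p) + - n"
    by (simp_all add: star_mult)
  then have "star m \<in> hmonomials (- n)" unfolding hmonomials_def using m(2,3) by blast
  then show ?case using span_step by (simp add: star_add star_sc span.span_step)
qed

text \<open>Cylinders have degree 0, so every homogeneous component of \<open>x\<close> commutes
  with them too. Components of negative degree are reduced to positive degree by
  \<open>star\<close>, which fixes cylinders and preserves \<open>normals\<close>.\<close>

theorem centralizer_in_core:
  assumes x: "x \<in> span monomials"
    and comm: "\<And>u p w. awalk u p w \<Longrightarrow> x * cyl u p = cyl u p * x"
  shows "x \<in> alg normals"
proof -
  have "deg n x \<in> alg normals" for n
  proof -
    have c: "deg n x * cyl u p = cyl u p * deg n x" if "awalk u p w" for u p w
      using arg_cong[OF comm[OF that], of "deg n"] by (simp add: deg_cyl_left[OF that] deg_cyl_right[OF that])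
    have s: "deg n x \<in> span (hmonomials n)" using deg_span[OF x] .
    show ?thesis
    proof (cases "n \<ge> 0")
      case True
      then show ?thesis using homogeneous_in_core[of "deg n x" "nat n"] s c by simp
    next
      case False
      have "star (deg n x) * cyl u p = cyl u p * star (deg n x)" if "awalk u p w" for u p w
        using arg_cong[OF c[OF that], of star] by (simp add: star_mult)
      then have "star (deg n x) \<in> alg normals"
        using False star_hmonomials[OF s] homogeneous_in_core[of "star (deg n x)" "nat (- n)"] by simp
      then show ?thesis using alg_star[OF _ star_normals] by fastforce
    qed
  qed
  moreover obtain F where "x = (\<Sum>n\<in>F. deg n x)" using deg_decomp[OF x] by blast
  ultimately show ?thesis using alg_sum[of F "\<lambda>n. deg n x" normals] by simp
qed


section \<open>Normal monomials commute\<close>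

text \<open>The class of coefficients admits the zero ring. This settles that case, and the
  remaining lemmas may assume that vertices are nonzero.\<close>

lemma all_zero: "(1::'r) = 0 \<Longrightarrow> (x::'a) = 0"
  using sc_one[of x] by simp

lemma V_nonzero: "(1::'r) \<noteq> 0 \<Longrightarrow> v \<in> verts E \<Longrightarrow> V v \<noteq> 0"
  using torsion_free[of v 1] by auto

lemma ge_cyl_pe: "awalk u p w \<Longrightarrow> ge u p * cyl u p * pe u p = V w"
  by (simp add: ge_cyl ge_pe_same)

lemma cyl_nonzero: "(1::'r) \<noteq> 0 \<Longrightarrow> awalk u p w \<Longrightarrow> cyl u p \<noteq> 0"
  using ge_cyl_pe[of u p w] V_nonzero[of w] awalk_last_in_verts[of u p w] by auto

text \<open>If the cylinder of the loop \<open>k\<close> is all of \<open>w\<close>, a walk leaving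
  \<open>k\<close> would have a nonzero cylinder orthogonal to \<open>V w\<close>. Hence every walk
  from \<open>w\<close> stays on the periodic repetition of \<open>k\<close>.\<close>

lemma closed_rigid:
  assumes one: "(1::'r) \<noteq> 0" and k: "awalk w k w" "k \<noteq> []" "cyl w k = V w"
  shows "rigid w"
proof (rule rigidI_prefix[OF k(2)])
  fix p t assume "awalk w p t"
  then show "prefix p (k @ p)"
  \<comment> \<open>Copies of \<open>k\<close> are stripped from the front of \<open>p\<close> until
    what remains is a prefix of \<open>k\<close>.\<close>
  proof (induction "length p" arbitrary: p rule: less_induct)
    case less
    have "cyl w p * cyl w k = cyl w p"
      using k(3) ge_V[OF less.prems] by (simp add: cyl_def mult.assoc)
    then have "\<not> parallel p k"
      using cyl_mult_zero[OF less.prems k(1)] cyl_nonzero[OF one less.prems] by auto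
    then consider "prefix p k" | p' where "p = k @ p'" by (auto simp: parallel_def prefix_def)
    then show ?case
    proof cases
      case 1 then show ?thesis by (meson prefix_prefix)
    next
      case 2
      have "awalk w p' t" using awalk_appendD[OF k(1)] less.prems 2 by simp
      then have "prefix p' (k @ p')" using less.hyps[of p'] 2 k(2) by simp
      then show ?thesis unfolding 2 by simp
    qed
  qed
qed

text \<open>Equal nonzero cylinders cannot come from diverging walks, so one of the two walks
  extends the other. The extra piece \<open>k\<close> is the loop, occurring as a path or as a ghost
  path.\<close>

lemma normal_form:
  assumes one: "(1::'r) \<noteq> 0" and x: "x \<in> normals"
  obtains u q w k y where "awalk u q w" "awalk w k w" "cyl w k = V w" "y = pe w k \<or> y = ge w k"
    "x = pe u q * y * ge u q"
proof -
  obtain u p u' q w where e: "x = pe u p * ge u' q" "awalk u p w" "awalk u' q w" "cyl u p = cyl u' q"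
    using x unfolding normals_def by blast
  have "cyl u p * cyl u' q \<noteq> 0"
    using cyl_idem[OF e(2)] e(4) cyl_nonzero[OF one e(2)] by simp
  then have u: "u' = u" "\<not> parallel p q" using cyl_mult_zero[OF e(2,3)] by auto
  \<comment> \<open>Conjugating the equal cylinders by \<open>b\<close> turns one into
    \<open>V w\<close> and the other into \<open>cyl w k\<close>.\<close>
  have loop: "awalk w k w \<and> cyl w k = V w"
    if "awalk u b w" "awalk u (b @ k) w" "cyl u (b @ k) = cyl u b" for b k
  proof -
    have k: "awalk w k w" using that by (blast intro: awalk_appendD)
    have "V w = ge u b * cyl u (b @ k) * pe u b" using ge_cyl_pe[OF that(1)] that(3) by simp
    also have "\<dots> = V w * cyl w k * V w"
      by (simp only: cyl_append[OF that(1) k] mult.assoc ge_pe_same[OF that(1)])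
        (simp only: ge_pe_same[OF that(1)] flip: mult.assoc)
    also have "\<dots> = cyl w k" using V_pe[OF k] ge_V[OF k] by (simp add: cyl_def mult.assoc) (simp flip: mult.assoc)
    finally show ?thesis using k by simp
  qed
  consider k where "p = q @ k" | k where "q = p @ k" using u(2) by (auto simp: parallel_def prefix_def)
  then show ?thesis
  proof cases
    case (1 k)
    then have k: "awalk w k w \<and> cyl w k = V w" using loop[of q k] e u by simp
    have "x = pe u q * pe w k * ge u q" using e u 1 k pe_append[of u q w k w] by simp
    then show ?thesis using that[of u q w k "pe w k"] e u k by simp
  next
    case (2 k)
    then have k: "awalk w k w \<and> cyl w k = V w" using loop[of p k] e u by simp
    have "x = pe u p * ge w k * ge u p" using e u 2 k ge_append[of u p w k w] by (simp add: mult.assoc)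
    then show ?thesis using that[of u p w k "ge w k"] e k by simp
  qed
qed

text \<open>\<open>x\<close> lives in the corner of \<open>cyl u q\<close>, and two cylinders are
  orthogonal or nested. A larger \<open>cyl s p\<close> acts on \<open>x\<close> as an identity; the
  smaller one is the case that needs the loop.\<close>

lemma cyl_normal_commute:
  assumes one: "(1::'r) \<noteq> 0" and x: "x \<in> normals" and p: "awalk s p t"
  shows "cyl s p * x = x * cyl s p"
proof -
  obtain u q w k y where q: "awalk u q w" and k: "awalk w k w" "cyl w k = V w" "y = pe w k \<or> y = ge w k"
    and xe: "x = pe u q * y * ge u q" using normal_form[OF one x] .
  have xc: "cyl u q * x = x" "x * cyl u q = x"
    unfolding xe using cyl_pe[OF q] ge_cyl[OF q] by (simp_all add: mult.assoc) (simp flip: mult.assoc)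
  consider "u \<noteq> s \<or> parallel q p" | r where "u = s" "q = p @ r" | r where "u = s" "p = q @ r"
    using prefix_or_parallel by metis
  then show ?thesis
  proof cases
    case 1
    then have "cyl s p * cyl u q = 0" "cyl u q * cyl s p = 0"
      using cyl_mult_zero[OF p q] cyl_mult_zero[OF q p] by (auto simp: parallel_commute)
    then have "cyl s p * (cyl u q * x) = 0" "(x * cyl u q) * cyl s p = 0"
      by (simp_all add: mult.assoc) (simp flip: mult.assoc)
    then show ?thesis using xc by simp
  next
    case (2 r)
    have r: "awalk t r w" using p q 2 by (auto intro: awalk_appendD)
    have "cyl s p * (cyl u q * x) = cyl u q * x" "(x * cyl u q) * cyl s p = x * cyl u q"
      using cyl_cyl_append[OF p r] 2 by (simp_all add: mult.assoc) (simp flip: mult.assoc)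
    then show ?thesis using xc by simp
  next
    case (3 r)
    have r: "awalk w r t" using p q 3 by (auto intro: awalk_appendD)
    show ?thesis
    proof (cases "k = []")
      case True
      then have "x = cyl u q"
        using xe k(3) pe_V[OF q] awalk_last_in_verts[OF q] by (auto simp: cyl_def ge_Nil)
      then show ?thesis using cyl_cyl_append[OF q r] 3 by simp
    next
      case False
      have "cyl w r = V w" using rigid_cyl[OF closed_rigid[OF one k(1) False k(2)] r] .
      \<comment> \<open>The loop is nontrivial, so \<open>w\<close> is rigid and prolonging
        \<open>q\<close> does not shrink its cylinder.\<close>
      then have "cyl s p = cyl u q"
        using cyl_append[OF q r] 3 pe_V[OF q] by (simp add: cyl_def)
      then show ?thesis using xc by simp
    qed
  qed
qed

text \<open>Here \<open>a'\<close> is an inverse of \<open>a\<close> in the corner of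
  \<open>e\<close>. Thus commutation of two paths carries over to their ghosts.\<close>

lemma commute_inverse:
  fixes a :: 'a
  assumes "a * a' = e" "a' * a = e" "e * b = b" "b * e = b" "a * b = b * a"
  shows "a' * b = b * a'"
proof -
  have "a' * b = a' * (b * a) * a'" using assms(1,4) by (simp add: mult.assoc)
  also have "\<dots> = (a' * a) * b * a'" using assms(5) by (simp add: mult.assoc)
  finally show ?thesis using assms(2,3) by simp
qed

lemma rigid_prefix:
  assumes "rigid w" "awalk w p s" "awalk w q t" "length p \<le> length q"
  obtains r where "q = p @ r"
proof -
  have "awalk w (take (length p) q @ drop (length p) q) t" using assms by simp
  then obtain v where "awalk w (take (length p) q) v" by (rule awalk_appendE)
  then have "take (length p) q = p" using assms by (intro rigidD[OF assms(1)]) auto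
  then show ?thesis using that[of "drop (length p) q"] append_take_drop_id[of "length p" q] by simp
qed

text \<open>\<open>S\<close> transports the corner at \<open>t\<close> to the corner at
  \<open>w\<close> along \<open>d\<close>; by rigidity it sends \<open>V t\<close> to
  \<open>V w\<close>. It is enough to treat two honest paths, since rigid loops are invertible in
  their corners.\<close>

lemma rigid_loops_commute:
  assumes w: "rigid w" and k: "awalk w k w" and d: "awalk w d t" and j: "awalk t j t"
    and y: "y = pe w k \<or> y = ge w k" and z: "z = pe t j \<or> z = ge t j"
  shows "y * (pe w d * z * ge w d) = (pe w d * z * ge w d) * y"
proof -
  define S where "S z = pe w d * z * ge w d" for z
  have t: "rigid t" using rigid_awalk[OF w d] .
  have dd: "pe w d * ge w d = V w" using rigid_cyl[OF w d] by (simp add: cyl_def)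
  have kk: "pe w k * ge w k = V w" "ge w k * pe w k = V w"
    using rigid_cyl[OF w k] ge_pe_same[OF k] by (simp_all add: cyl_def)
  have jj: "pe t j * ge t j = V t" "ge t j * pe t j = V t"
    using rigid_cyl[OF t j] ge_pe_same[OF j] by (simp_all add: cyl_def)
  have SV: "V w * S z = S z" "S z * V w = S z" for z
    unfolding S_def using V_pe[OF d] ge_V[OF d] by (simp_all add: mult.assoc) (simp flip: mult.assoc)
  have SS: "S x * S z = S (x * V t * z)" for x z
    using ge_pe_same[OF d] by (simp add: S_def mult.assoc) (metis mult.assoc)
  have pj: "pe t j * V t = pe t j" "ge t j * V t = ge t j" using pe_V[OF j] ge_V[OF j] .
  have SVt: "S (V t) = V w" unfolding S_def using pe_V[OF d] dd by simp
  have inv: "S (pe t j) * S (ge t j) = V w" "S (ge t j) * S (pe t j) = V w"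
    by (simp_all add: SS pj jj SVt)
  have kd: "awalk w (k @ d) t" using awalk_append[OF k d] .
  \<comment> \<open>\<open>k'\<close> is the loop \<open>k\<close> seen from \<open>t\<close>, that
    is, transported along \<open>d\<close>.\<close>
  obtain k' where k': "k @ d = d @ k'" using rigid_prefix[OF w d kd] by auto
  have wk': "awalk t k' t" using awalk_appendD[OF d] kd unfolding k' by simp
  have base: "pe w k * S (pe t j) = S (pe t j) * pe w k"
  proof -
    have "pe w k * S (pe t j) = pe w ((k @ d) @ j) * ge w d"
      by (simp only: S_def pe_append[OF kd j] pe_append[OF k d] mult.assoc)
    \<comment> \<open>Two walks of equal length from the rigid vertex \<open>w\<close> coincide;
      this is where the order of the loops is exchanged.\<close>
    also have "(k @ d) @ j = d @ (j @ k')"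
      using arg_cong[OF k', of length] awalk_append[OF kd j] awalk_append[OF d awalk_append[OF j wk']]
      by (intro rigidD[OF w, of _ t _ t]) auto
    also have "pe w (d @ (j @ k')) = pe w d * pe t j * pe t k'"
      by (simp add: pe_append[OF d awalk_append[OF j wk']] pe_append[OF j wk'] mult.assoc)
    also have "pe t k' = ge w d * pe w (k @ d)" unfolding k' using ge_pe_append[OF d wk'] by simp
    also have "pe w (k @ d) = pe w k * pe w d" using pe_append[OF k d] .
    also have "pe w d * pe t j * (ge w d * (pe w k * pe w d)) * ge w d = S (pe t j) * (pe w k * (pe w d * ge w d))"
      by (simp add: S_def mult.assoc)
    also have "\<dots> = S (pe t j) * pe w k" using pe_V[OF k] dd by simp
    finally show ?thesis .
  qed
  have yV: "V w * pe w k = pe w k" "pe w k * V w = pe w k" "V w * ge w k = ge w k" "ge w k * V w = ge w k"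
    using V_pe[OF k] pe_V[OF k] V_ge[OF k] ge_V[OF k] .
  have 1: "ge w k * S (pe t j) = S (pe t j) * ge w k"
    using commute_inverse[OF kk SV base] .
  have "S (ge t j) * pe w k = pe w k * S (ge t j)"
    using commute_inverse[OF inv yV(1,2) base[symmetric]] .
  moreover have "S (ge t j) * ge w k = ge w k * S (ge t j)"
    using commute_inverse[OF inv yV(3,4) 1[symmetric]] .
  ultimately show ?thesis using y z base 1 unfolding S_def by auto
qed

text \<open>In normal form, trivial loops give cylinders. For two nontrivial loops the conjugating
  paths either diverge, making both products zero, or are nested, and then the claim reduces to
  loops at rigid vertices.\<close>

theorem normals_commute:
  assumes "x \<in> normals" "x' \<in> normals" shows "x * x' = x' * x"
proof (cases "(1::'r) = 0")
  case True then show ?thesis using all_zero[of x] by simp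
next
  case one: False
  obtain u q w k y where q: "awalk u q w" and k: "awalk w k w" "cyl w k = V w" "y = pe w k \<or> y = ge w k"
    and xe: "x = pe u q * y * ge u q" using normal_form[OF one assms(1)] .
  obtain u' q' w' k' y' where q': "awalk u' q' w'"
    and k': "awalk w' k' w'" "cyl w' k' = V w'" "y' = pe w' k' \<or> y' = ge w' k'"
    and xe': "x' = pe u' q' * y' * ge u' q'" using normal_form[OF one assms(2)] .
  \<comment> \<open>Both elements are conjugates by \<open>pe u q\<close>, so the equation pulls
    back to the corner at \<open>w\<close>.\<close>
  have nest: "(pe u q * y * ge u q) * (pe u (q @ d) * y' * ge u (q @ d))
      = (pe u (q @ d) * y' * ge u (q @ d)) * (pe u q * y * ge u q)"
    if q: "awalk u q w" and qd: "awalk u (q @ d) w'" and k: "awalk w k w" "rigid w" "y = pe w k \<or> y = ge w k"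
      and k': "awalk w' k' w'" "y' = pe w' k' \<or> y' = ge w' k'" for u q w d w' k y k' y'
  proof -
    have d: "awalk w d w'" using awalk_appendD[OF q qd] .
    define z where "z = pe w d * y' * ge w d"
    have yV: "y * V w = y" "V w * y = y" using k(3) V_pe[OF k(1)] pe_V[OF k(1)] V_ge[OF k(1)] ge_V[OF k(1)] by auto
    have z: "pe u (q @ d) * y' * ge u (q @ d) = pe u q * z * ge u q"
      by (simp add: z_def pe_append[OF q d] ge_append[OF q d] mult.assoc)
    have mult: "(pe u q * a * ge u q) * (pe u q * b * ge u q) = pe u q * (a * V w * b) * ge u q" for a b
      using ge_pe_same[OF q] by (simp add: mult.assoc) (metis mult.assoc)
    have "y * z = z * y" unfolding z_def using rigid_loops_commute[OF k(2,1) d k'(1) k(3) k'(2)] .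
    then show ?thesis unfolding z mult by (simp add: yV mult.assoc)
  qed
  show ?thesis
  proof (cases "k = [] \<or> k' = []")
    case True
    then have "x = cyl u q \<or> x' = cyl u' q'"
      using xe k(3) pe_V[OF q] awalk_last_in_verts[OF q] xe' k'(3) pe_V[OF q'] awalk_last_in_verts[OF q']
      by (auto simp: cyl_def ge_Nil)
    then show ?thesis using cyl_normal_commute[OF one assms(1) q'] cyl_normal_commute[OF one assms(2) q] by auto
  next
    case False
    then have r: "rigid w" "rigid w'" using closed_rigid[OF one] k k' by auto
    consider "u \<noteq> u' \<or> parallel q q'" | r where "u = u'" "q' = q @ r" | r where "u = u'" "q = q' @ r"
      using prefix_or_parallel by metis
    then show ?thesis
    proof cases
      case 1
      then have "ge u q * pe u' q' = 0" "ge u' q' * pe u q = 0"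
        using ge_pe_parallel[OF q] ge_pe_parallel[OF q'] ge_pe_diff[OF q q'] ge_pe_diff[OF q' q] q q'
        by (auto simp: parallel_commute) (metis parallel_commute)+
      then have "pe u q * y * (ge u q * pe u' q') * y' * ge u' q' = 0"
        "pe u' q' * y' * (ge u' q' * pe u q) * y * ge u q = 0" by simp_all
      then show ?thesis unfolding xe xe' by (simp add: mult.assoc)
    next
      case (2 d)
      then show ?thesis unfolding xe xe' using nest[OF q _ k(1) r(1) k(3) k'(1,3)] q' by simp
    next
      case (3 d)
      then show ?thesis unfolding xe xe' using nest[OF q' _ k'(1) r(2) k'(3) k(1,3)] q by simp
    qed
  qed
qed

section \<open>Multiplying path monomials by generators\<close>

lemma monomialsI: "awalk u p w \<Longrightarrow> awalk u' q w \<Longrightarrow> pe u p * ge u' q \<in> monomials"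
  unfolding monomials_def by blast

lemma V_monomials: "v \<in> verts E \<Longrightarrow> V v \<in> monomials"
  using monomialsI[of v "[]" v v "[]"] by (simp add: awalk_Nil_iff ge_Nil V_mult)

lemma V_mult_monomial:
  assumes "v \<in> verts E" "x \<in> monomials" shows "V v * x \<in> span monomials"
proof -
  obtain u p u' q w where x: "x = pe u p * ge u' q" "awalk u p w" "awalk u' q w"
    using assms(2) unfolding monomials_def by blast
  have "V v * x = (V v * V u) * (pe u p * ge u' q)" using V_pe[OF x(2)] by (simp add: x(1) mult.assoc flip: mult.assoc[of "V u" "pe u p"])
  also have "\<dots> = (if v = u then x else 0)"
    using V_mult[OF assms(1) awalk_hd_in_verts[OF x(2)]] V_pe[OF x(2)] by (auto simp: x(1) simp flip: mult.assoc)
  finally show ?thesis using assms(2) by (simp add: span_base span_zero)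
qed

lemma Ed_mult_monomial:
  assumes e: "e \<in> arcs E" and "x \<in> monomials" shows "Ed e * x \<in> span monomials"
proof -
  obtain u p u' q w where x: "x = pe u p * ge u' q" "awalk u p w" "awalk u' q w"
    using assms(2) unfolding monomials_def by blast
  show ?thesis
  proof (cases "u = head E e")
    case True
    then have "Ed e * x = pe (tail E e) (e # p) * ge u' q" by (simp add: x(1) mult.assoc)
    moreover have "awalk (tail E e) (e # p) w" using x(2) e True by (simp add: awalk_Cons_iff)
    ultimately show ?thesis using monomialsI[OF _ x(3), of "tail E e" "e # p"] by (simp add: span_base)
  next
    case False
    have "Ed e * x = Ed e * (V (head E e) * V u) * (pe u p * ge u' q)"
      using V_pe[OF x(2)] Ed_head[OF e] by (metis x(1) mult.assoc)
    then show ?thesis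
      using V_mult[OF head_in_verts[OF e] awalk_hd_in_verts[OF x(2)]] False by (simp add: span_zero)
  qed
qed

text \<open>The ghost edge is absorbed into the ghost part when the path part is empty; otherwise it
  cancels the first edge or gives zero.\<close>

lemma star_Ed_mult_monomial:
  assumes e: "e \<in> arcs E" and "x \<in> monomials" shows "star (Ed e) * x \<in> span monomials"
proof -
  obtain u p u' q w where x: "x = pe u p * ge u' q" "awalk u p w" "awalk u' q w"
    using assms(2) unfolding monomials_def by blast
  have te: "awalk (tail E e) [e] (head E e)" using e out_arcs_awalk[of e "tail E e"] by simp
  have star_e: "star (Ed e) = ge (tail E e) [e]" using e by (simp add: ge_def Ed_head)
  show ?thesis
  proof (cases p)
    case Nil
    then have u: "u = w" "u \<in> verts E" using x(2) by (auto simp: awalk_Nil_iff)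
    have V_ge_u: "V u * ge u' q = ge u' q" using V_ge[OF x(3)] u by simp
    show ?thesis
    proof (cases "u = tail E e")
      case True
      have a: "awalk u' (q @ [e]) (head E e)" using awalk_append[OF x(3)] te True u by simp
      have "star (Ed e) * x = ge u' (q @ [e])"
        using ge_append[OF x(3), of "[e]" "head E e"] te True u Nil x(1) V_ge_u star_e by simp
      also have "\<dots> = pe (head E e) [] * ge u' (q @ [e])" using V_ge[OF a] by simp
      finally show ?thesis
        using monomialsI[OF _ a, of "head E e" "[]"] head_in_verts[OF e] by (simp add: awalk_Nil_iff span_base)
    next
      case False
      have "star (Ed e) * V u = 0"
        using ge_pe_diff[OF te, of u "[]" u] False u star_e by (simp add: awalk_Nil_iff)
      then show ?thesis using Nil x(1) by (simp add: span_zero flip: mult.assoc)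
    qed
  next
    case (Cons f p')
    have f: "f \<in> arcs E" "awalk (head E f) p' w" using x(2) Cons by (auto simp: awalk_Cons_iff)
    have "star (Ed e) * x = (star (Ed e) * Ed f) * (pe (head E f) p' * ge u' q)"
      by (simp add: x(1) Cons mult.assoc)
    also have "\<dots> = (if e = f then pe (head E f) p' * ge u' q else 0)"
      using CK1[OF e f(1)] V_pe[OF f(2)] by (simp flip: mult.assoc)
    finally show ?thesis using monomialsI[OF f(2) x(3)] by (simp add: span_base span_zero)
  qed
qed

lemma span_mult_left:
  assumes "\<And>x. x \<in> X \<Longrightarrow> a * x \<in> span X" "x \<in> span X" shows "a * x \<in> span X"
  using assms(2)
  by induction (auto simp: distrib_left sc_mult_right assms(1) span_sc span_add span_zero)

end


section \<open>The free algebra: degrees and torsion-freeness of vertices\<close>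

lemma poly_mapping_sum_single: "p = (\<Sum>w\<in>Poly_Mapping.keys p. Poly_Mapping.single w (Poly_Mapping.lookup p w))"
proof (rule poly_mapping_eqI)
  fix k
  have "(\<Sum>w\<in>Poly_Mapping.keys p. Poly_Mapping.lookup p w when w = k) = Poly_Mapping.lookup p k"
    by (cases "k \<in> Poly_Mapping.keys p") (auto simp: when_def in_keys_iff)
  then show "Poly_Mapping.lookup p k
      = Poly_Mapping.lookup (\<Sum>w\<in>Poly_Mapping.keys p. Poly_Mapping.single w (Poly_Mapping.lookup p w)) k"
    by (simp add: lookup_sum lookup_single)
qed

text \<open>Unlike \<open>pm_induct\<close>, this induction ranges only over nonempty words in the
  generators of \<open>E\<close>. It is proved for partial sums over subsets of the support.\<close>

lemma free_lpa_induct [consumes 1, case_names zero single add]: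
  assumes "a \<in> free_lpa E" "P 0"
    "\<And>w r. letters w \<noteq> [] \<Longrightarrow> set (letters w) \<subseteq> lgens E \<Longrightarrow> P (Poly_Mapping.single w r)"
    "\<And>p q. P p \<Longrightarrow> P q \<Longrightarrow> P (p + q)"
  shows "P a"
proof -
  have "P (\<Sum>w\<in>W. Poly_Mapping.single w (Poly_Mapping.lookup a w))"
    if "finite W" "W \<subseteq> Poly_Mapping.keys a" for W
    using that by (induction) (use assms in \<open>auto simp: free_lpa_def\<close>)
  from this[of "Poly_Mapping.keys a"] show ?thesis by (simp flip: poly_mapping_sum_single)
qed

fun gen_degree :: "('v, 'e) lgen \<Rightarrow> int" where
  "gen_degree (Vert v) = 0"
| "gen_degree (Edge e) = 1"
| "gen_degree (Ghost e) = - 1"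

definition word_degree :: "('v, 'e) lgen gword \<Rightarrow> int" where
  "word_degree w = sum_list (map gen_degree (letters w))"

lemma word_degree_plus: "word_degree (v + w) = word_degree v + word_degree w"
  by (simp add: word_degree_def plus_gword_def)

lemma word_degree_zero [simp]: "word_degree 0 = 0"
  by (simp add: word_degree_def zero_gword_def)

lift_definition free_deg :: "int \<Rightarrow> (('v, 'e) lgen gword \<Rightarrow>\<^sub>0 'r::zero) \<Rightarrow> ('v, 'e) lgen gword \<Rightarrow>\<^sub>0 'r"
  is "\<lambda>n f w. if word_degree w = n then f w else 0"
  by (rule finite_subset) auto

lemma free_deg_single: "free_deg n (Poly_Mapping.single w r) = (if word_degree w = n then Poly_Mapping.single w r else 0)"
  by (rule poly_mapping_eqI) (auto simp: free_deg.rep_eq lookup_single when_def)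

lemma free_deg_add: "free_deg n (p + q) = free_deg n p + free_deg n (q :: ('v, 'e, 'r::{comm_ring, comm_monoid_mult}) free_alg)"
  by (rule poly_mapping_eqI) (auto simp: free_deg.rep_eq lookup_add)

lemma free_deg_diff: "free_deg n (p - q) = free_deg n p - free_deg n (q :: ('v, 'e, 'r::{comm_ring, comm_monoid_mult}) free_alg)"
  by (rule poly_mapping_eqI) (auto simp: free_deg.rep_eq lookup_minus)

lemma free_deg_zero [simp]: "free_deg n 0 = 0"
  by (rule poly_mapping_eqI) (auto simp: free_deg.rep_eq)

lemma free_deg_sum: "free_deg n (sum f A) = (\<Sum>i\<in>A. free_deg n (f i :: ('v, 'e, 'r::{comm_ring, comm_monoid_mult}) free_alg))"
  by (induction A rule: infinite_finite_induct) (auto simp: free_deg_add)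

lemma free_deg_mult_left:
  "free_deg n (Poly_Mapping.single w r * p) = Poly_Mapping.single w r * free_deg (n - word_degree w) p"
  for p :: "('v, 'e, 'r::{comm_ring, comm_monoid_mult}) free_alg"
  by (induction p rule: pm_induct)
    (auto simp: mult_single free_deg_single word_degree_plus free_deg_add distrib_left)

lemma free_deg_mult_right:
  "free_deg n (p * Poly_Mapping.single w r) = free_deg (n - word_degree w) p * Poly_Mapping.single w r"
  for p :: "('v, 'e, 'r::{comm_ring, comm_monoid_mult}) free_alg"
  by (induction p rule: pm_induct)
    (auto simp: mult_single free_deg_single word_degree_plus free_deg_add distrib_right)

lemma free_deg_smult: "free_deg n (free_smult r p) = free_smult r (free_deg n p)"
  by (simp add: free_smult_def free_deg_mult_left)

lemma free_deg_free: "p \<in> free_lpa E \<Longrightarrow> free_deg n p \<in> free_lpa E"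
  by (auto simp: free_lpa_def in_keys_iff free_deg.rep_eq split: if_splits)

lemma free_deg_word_mono: "free_deg n (word_mono gs) = (if sum_list (map gen_degree gs) = n then word_mono gs else 0)"
  by (simp add: word_mono_def free_deg_single word_degree_def)

text \<open>Every defining relation is homogeneous, so a component of it is the relation itself or
  zero.\<close>

lemma free_deg_relation: "p \<in> lpa_relations E \<Longrightarrow> free_deg n p \<in> lpa_ideal E"
  by (induction rule: lpa_relations.induct)
    (auto simp: free_deg_diff free_deg_word_mono free_deg_sum
      intro: lpa_ideal.zero lpa_ideal.rel lpa_relations.intros)

lemma free_deg_ideal: "p \<in> lpa_ideal E \<Longrightarrow> free_deg n p \<in> lpa_ideal E"
proof (induction arbitrary: n rule: lpa_ideal.induct)
  case (mult_left a p)
  from mult_left.hyps(1) show ?case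
    by (induction rule: free_lpa_induct)
      (auto simp: free_deg_mult_left free_deg_add distrib_right free_lpa_def
        intro!: lpa_ideal.zero lpa_ideal.add lpa_ideal.mult_left mult_left.IH)
next
  case (mult_right a p)
  from mult_right.hyps(1) show ?case
    by (induction rule: free_lpa_induct)
      (auto simp: free_deg_mult_right free_deg_add distrib_left free_lpa_def
        intro!: lpa_ideal.zero lpa_ideal.add lpa_ideal.mult_right mult_right.IH)
qed (auto simp: free_deg_relation free_deg_add free_deg_smult intro: lpa_ideal.intros)

text \<open>
  Vertices are torsion-free because the Leavitt path algebra acts on the functions
  \<open>verts E \<times> K \<Rightarrow> R\<close>, where \<open>K\<close> is so large that \<open>b v\<close> can identify
  \<open>out_arcs E v \<times> K\<close> with \<open>K\<close> whenever \<open>v\<close> is not a sink; \<open>c v\<close> is the inverse of \<open>b v\<close>.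
\<close>

locale branching = wf_digraph E
  for E :: "('v, 'e) pre_digraph" +
  fixes b :: "'v \<Rightarrow> 'e \<times> 'k \<Rightarrow> 'k" and c :: "'v \<Rightarrow> 'k \<Rightarrow> 'e \<times> 'k"
  assumes c_b: "e \<in> out_arcs E v \<Longrightarrow> c v (b v (e, k)) = (e, k)"
    and b_c: "out_arcs E v \<noteq> {} \<Longrightarrow> b v (c v k) = k"
    and c_out: "out_arcs E v \<noteq> {} \<Longrightarrow> fst (c v k) \<in> out_arcs E v"
begin

text \<open>Through \<open>b v\<close>, a function at a non-sink \<open>v\<close> is a family
  indexed by the edges leaving \<open>v\<close>. \<open>Edge e\<close> puts a function at the head
  into member \<open>e\<close> at the tail, and \<open>Ghost e\<close> reads that member
  back.\<close>

fun gen_act :: "('v, 'e) lgen \<Rightarrow> ('v \<Rightarrow> 'k \<Rightarrow> 'r::{comm_ring, comm_monoid_mult}) \<Rightarrow> 'v \<Rightarrow> 'k \<Rightarrow> 'r" where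
  "gen_act (Vert v) f = (\<lambda>u k. if u = v then f u k else 0)"
| "gen_act (Edge e) f = (\<lambda>u k. if u = tail E e \<and> fst (c u k) = e then f (head E e) (snd (c u k)) else 0)"
| "gen_act (Ghost e) f = (\<lambda>u k. if u = head E e then f (tail E e) (b (tail E e) (e, k)) else 0)"

definition word_act :: "('v, 'e) lgen list \<Rightarrow> ('v \<Rightarrow> 'k \<Rightarrow> 'r::{comm_ring, comm_monoid_mult}) \<Rightarrow> 'v \<Rightarrow> 'k \<Rightarrow> 'r" where
  "word_act gs f = foldr gen_act gs f"

definition act :: "('v, 'e, 'r::{comm_ring, comm_monoid_mult}) free_alg \<Rightarrow> ('v \<Rightarrow> 'k \<Rightarrow> 'r) \<Rightarrow> 'v \<Rightarrow> 'k \<Rightarrow> 'r" where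
  "act p f = (\<lambda>u k. \<Sum>w\<in>Poly_Mapping.keys p. Poly_Mapping.lookup p w * word_act (letters w) f u k)"

lemma gen_act_add: "gen_act g (\<lambda>u k. f u k + f' u k) = (\<lambda>u k. gen_act g f u k + gen_act g f' u k)"
  by (cases g) (auto simp: fun_eq_iff)
lemma gen_act_scale: "gen_act g (\<lambda>u k. r * f u k) = (\<lambda>u k. r * gen_act g f u k)"
  by (cases g) (auto simp: fun_eq_iff)

lemma word_act_add: "word_act gs (\<lambda>u k. f u k + f' u k) = (\<lambda>u k. word_act gs f u k + word_act gs f' u k)"
  by (induction gs) (simp_all add: word_act_def gen_act_add)
lemma word_act_scale: "word_act gs (\<lambda>u k. r * f u k) = (\<lambda>u k. r * word_act gs f u k)"
  by (induction gs) (simp_all add: word_act_def gen_act_scale)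

lemma act_add: "act (p + q) f = (\<lambda>u k. act p f u k + act q f u k)"
  unfolding act_def
  by (intro ext setsum_keys_plus_distrib) (auto simp: distrib_right)

lemma act_single: "act (Poly_Mapping.single w r) f = (\<lambda>u k. r * word_act (letters w) f u k)"
  by (cases "r = 0") (auto simp: act_def fun_eq_iff)

lemma act_zero [simp]: "act 0 f = (\<lambda>u k. 0)"
  by (simp add: act_def)

lemma act_add_right: "act p (\<lambda>u k. f u k + f' u k) = (\<lambda>u k. act p f u k + act p f' u k)"
  by (simp add: act_def word_act_add distrib_left sum.distrib)

lemma act_scale_right: "act p (\<lambda>u k. r * f u k) = (\<lambda>u k. r * act p f u k)"
  by (simp add: act_def word_act_scale sum_distrib_left mult.left_commute)

lemma act_zero_right: "act p (\<lambda>u k. 0) = (\<lambda>u k. 0)"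
  using act_scale_right[of p 0 "\<lambda>u k. 0"] by simp

lemma act_mult: "act (p * q) f = act p (act q f)"
proof (induction q rule: pm_induct)
  case (single w r)
  show ?case
    by (induction p rule: pm_induct)
      (auto simp: mult_single act_single act_add distrib_right plus_gword_def word_act_def[of "_ @ _"]
        word_act_scale mult.assoc simp flip: word_act_def)
next
  case (sum q q')
  then show ?case by (simp add: act_add act_add_right distrib_left)
qed

lemma act_uminus: "act (- p) f = (\<lambda>u k. - act p f u k)"
  by (simp add: act_def sum_negf)

lemma act_diff: "act (p - q) f = (\<lambda>u k. act p f u k - act q f u k)"
  using act_add[of p "- q" f] by (simp add: act_uminus)

lemma act_sum: "act (sum p A) f = (\<lambda>u k. \<Sum>i\<in>A. act (p i) f u k)"
  by (induction A rule: infinite_finite_induct) (auto simp: act_add)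

lemma act_word_mono: "act (word_mono gs) f = word_act gs f"
  by (simp add: word_mono_def act_single)

lemma act_relation: "p \<in> lpa_relations E \<Longrightarrow> act p f = (\<lambda>u k. 0)"
proof (induction rule: lpa_relations.induct)
  case (CK2 v)
  have out: "out_arcs E v \<noteq> {}" "finite (out_arcs E v)" using CK2 by (auto simp: regular_vertex_def)
  have "word_act [Vert v] f u k = (\<Sum>e\<in>out_arcs E v. word_act [Edge e, Ghost e] f u k)" for u k
  proof (cases "u = v")
    case True
    \<comment> \<open>An edge followed by its ghost restricts to the indices \<open>k\<close> that
      \<open>c v\<close> assigns to \<open>e\<close>. Each \<open>k\<close> belongs to exactly one
      edge, so the sum over the edges is the identity at \<open>v\<close>.\<close>
    have "word_act [Edge e, Ghost e] f u k = (if e = fst (c v k) then f v k else 0)" if "e \<in> out_arcs E v" for e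
      using that b_c[OF out(1), of k] True by (auto simp: word_act_def)
    then show ?thesis using out c_out[OF out(1), of k] True by (simp add: word_act_def)
  next
    case False
    then have "word_act [Edge e, Ghost e] f u k = 0" if "e \<in> out_arcs E v" for e
      using that by (auto simp: word_act_def)
    then show ?thesis using False by (simp add: word_act_def)
  qed
  then show ?case by (simp add: act_diff act_sum act_word_mono)
qed (auto simp: act_diff act_word_mono word_act_def fun_eq_iff c_b)

lemma act_ideal: "p \<in> lpa_ideal E \<Longrightarrow> act p f = (\<lambda>u k. 0)"
  by (induction arbitrary: f rule: lpa_ideal.induct)
    (auto simp: act_relation act_add act_mult act_zero_right free_smult_def)

lemma vertex_torsion_free:
  assumes "free_smult r (word_mono [Vert v]) \<in> lpa_ideal E" shows "r = 0"
  \<comment> \<open>At \<open>v\<close>, the element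
    \<open>free_smult r (word_mono [Vert v])\<close> sends the constant function 1 to
    \<open>r\<close>.\<close>
  using fun_cong[OF fun_cong[OF act_ideal[OF assms, of "\<lambda>u k. 1"]], of v]
  by (simp add: free_smult_def word_mono_def mult_single plus_gword_def zero_gword_def act_single word_act_def)

end

lemma (in wf_digraph) vertex_torsion_free:
  assumes "free_smult r (word_mono [Vert v]) \<in> lpa_ideal G" shows "r = 0"
proof -
  \<comment> \<open>The index type is infinite and at least as large as the edge type, so its
    product with any nonempty set of edges is equipotent to it.\<close>
  have inf: "\<not> finite (UNIV :: ('b + nat) set)" by (simp add: UNIV_Plus_UNIV[symmetric] del: UNIV_Plus_UNIV)
  have "\<exists>b. bij_betw b (out_arcs G v \<times> (UNIV :: ('b + nat) set)) (UNIV :: ('b + nat) set)" if "out_arcs G v \<noteq> {}" for v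
  proof -
    include cardinal_syntax
    have "inj_on (Inl :: 'b \<Rightarrow> 'b + nat) (out_arcs G v)" by simp
    then have le: "|out_arcs G v| \<le>o |UNIV :: ('b + nat) set|"
      using card_of_ordLeq[of "out_arcs G v" "UNIV :: ('b + nat) set"] by blast
    show ?thesis by (rule card_of_ordIso[THEN iffD2, OF card_of_Times_infinite_simps(3)[OF inf that le]])
  qed
  then obtain b where b: "\<And>v. out_arcs G v \<noteq> {} \<Longrightarrow> bij_betw (b v) (out_arcs G v \<times> (UNIV :: ('b + nat) set)) (UNIV :: ('b + nat) set)"
    by metis
  interpret branching G b "\<lambda>v. inv_into (out_arcs G v \<times> UNIV) (b v)"
  proof unfold_locales
    fix e v and k :: "'b + nat" assume e: "e \<in> out_arcs G v"
    then show "inv_into (out_arcs G v \<times> UNIV) (b v) (b v (e, k)) = (e, k)"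
      using bij_betw_imp_inj_on[OF b] by (intro inv_into_f_f) blast+
  next
    fix v and k :: "'b + nat" assume v: "out_arcs G v \<noteq> {}"
    have k: "k \<in> b v ` (out_arcs G v \<times> UNIV)" using bij_betw_imp_surj_on[OF b[OF v]] by simp
    show "b v (inv_into (out_arcs G v \<times> UNIV) (b v) k) = k" using f_inv_into_f[OF k] .
    show "fst (inv_into (out_arcs G v \<times> UNIV) (b v) k) \<in> out_arcs G v"
      using inv_into_into[OF k] by auto
  qed
  show ?thesis using vertex_torsion_free[OF assms] .
qed


section \<open>Leavitt path algebras inside a ring type\<close>

text \<open>
  The quotient of the free algebra depends on the graph, so it is not a type. The product of these
  quotients over all graphs is one, and it is an instance of \<open>ring\<close>; the Leavitt path
  algebra of \<open>E\<close> embeds as the factor at \<open>E\<close>.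
\<close>

definition lpa_family_rel :: "(('v, 'e) pre_digraph \<Rightarrow> ('v, 'e, 'r::{comm_ring, comm_monoid_mult}) free_alg)
    \<Rightarrow> (('v, 'e) pre_digraph \<Rightarrow> ('v, 'e, 'r) free_alg) \<Rightarrow> bool" where
  "lpa_family_rel f g \<longleftrightarrow> (\<forall>E. f E \<in> free_lpa E \<and> g E \<in> free_lpa E \<and> f E - g E \<in> lpa_ideal E)"

quotient_type (overloaded) ('v, 'e, 'r) lpa_prod =
  "('v, 'e) pre_digraph \<Rightarrow> ('v, 'e, 'r::{comm_ring, comm_monoid_mult}) free_alg" / partial: lpa_family_rel
proof (rule part_equivpI)
  show "\<exists>f. lpa_family_rel f (f :: ('v, 'e) pre_digraph \<Rightarrow> ('v, 'e, 'r) free_alg)"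
    by (rule exI[of _ "\<lambda>_. 0"]) (simp add: lpa_family_rel_def free_lpa_zero lpa_ideal.zero)
  show "symp (lpa_family_rel :: (('v, 'e) pre_digraph \<Rightarrow> ('v, 'e, 'r) free_alg) \<Rightarrow> _)"
    by (rule sympI) (use lpa_ideal_uminus in \<open>fastforce simp: lpa_family_rel_def\<close>)
  show "transp (lpa_family_rel :: (('v, 'e) pre_digraph \<Rightarrow> ('v, 'e, 'r) free_alg) \<Rightarrow> _)"
  proof (rule transpI)
    fix f g h :: "('v, 'e) pre_digraph \<Rightarrow> ('v, 'e, 'r) free_alg"
    assume "lpa_family_rel f g" "lpa_family_rel g h"
    then show "lpa_family_rel f h"
      using lpa_ideal.add[of "f E - g E" E "g E - h E" for E] by (auto simp: lpa_family_rel_def)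
  qed
qed

instantiation lpa_prod :: (type, type, "{comm_ring, comm_monoid_mult}") ring
begin

lift_definition zero_lpa_prod :: "('a, 'b, 'c) lpa_prod" is "\<lambda>_. 0"
  by (simp add: lpa_family_rel_def free_lpa_zero lpa_ideal.zero)

lift_definition plus_lpa_prod :: "('a, 'b, 'c) lpa_prod \<Rightarrow> ('a, 'b, 'c) lpa_prod \<Rightarrow> ('a, 'b, 'c) lpa_prod"
  is "\<lambda>f g E. f E + g E"
  by (auto simp: lpa_family_rel_def free_lpa_add add_diff_add intro: lpa_ideal.add)

lift_definition minus_lpa_prod :: "('a, 'b, 'c) lpa_prod \<Rightarrow> ('a, 'b, 'c) lpa_prod \<Rightarrow> ('a, 'b, 'c) lpa_prod"
  is "\<lambda>f g E. f E - g E"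
proof -
  fix f f' g g' :: "('a, 'b) pre_digraph \<Rightarrow> ('a, 'b, 'c) free_alg"
  assume a: "lpa_family_rel f f'" "lpa_family_rel g g'"
  have eq: "(f E - g E) - (f' E - g' E) = (f E - f' E) - (g E - g' E)" for E by simp
  have "(f E - g E) - (f' E - g' E) \<in> lpa_ideal E" for E
    unfolding eq by (rule lpa_ideal_diff) (use a in \<open>auto simp: lpa_family_rel_def\<close>)
  then show "lpa_family_rel (\<lambda>E. f E - g E) (\<lambda>E. f' E - g' E)"
    using a by (simp add: lpa_family_rel_def free_lpa_diff)
qed

lift_definition uminus_lpa_prod :: "('a, 'b, 'c) lpa_prod \<Rightarrow> ('a, 'b, 'c) lpa_prod"
  is "\<lambda>f E. - f E"
proof -
  fix f f' :: "('a, 'b) pre_digraph \<Rightarrow> ('a, 'b, 'c) free_alg"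
  assume "lpa_family_rel f f'"
  then show "lpa_family_rel (\<lambda>E. - f E) (\<lambda>E. - f' E)"
    using lpa_ideal_uminus[of "f E - f' E" E for E] free_lpa_diff[OF free_lpa_zero, of _ E for E]
    by (auto simp: lpa_family_rel_def)
qed

lift_definition times_lpa_prod :: "('a, 'b, 'c) lpa_prod \<Rightarrow> ('a, 'b, 'c) lpa_prod \<Rightarrow> ('a, 'b, 'c) lpa_prod"
  is "\<lambda>f g E. f E * g E"
proof -
  fix f f' g g' :: "('a, 'b) pre_digraph \<Rightarrow> ('a, 'b, 'c) free_alg"
  assume a: "lpa_family_rel f f'" "lpa_family_rel g g'"
  have eq: "f E * g E - f' E * g' E = (f E - f' E) * g E + f' E * (g E - g' E)" for E
    by (simp add: algebra_simps)
  have "f E * g E - f' E * g' E \<in> lpa_ideal E" for E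
    unfolding eq using a
    by (intro lpa_ideal.add lpa_ideal.mult_left lpa_ideal.mult_right) (auto simp: lpa_family_rel_def)
  then show "lpa_family_rel (\<lambda>E. f E * g E) (\<lambda>E. f' E * g' E)"
    using a by (simp add: lpa_family_rel_def free_lpa_mult)
qed

lemmas lpa_family_simps = lpa_family_rel_def free_lpa_add free_lpa_mult free_lpa_diff free_lpa_zero lpa_ideal.zero

instance
proof
  fix a b c :: "('a, 'b, 'c) lpa_prod"
  show "a + b + c = a + (b + c)" by transfer (simp add: lpa_family_simps add.assoc)
  show "a + b = b + a" by transfer (simp add: lpa_family_simps add.commute)
  show "0 + a = a" by transfer (simp add: lpa_family_simps)
  show "- a + a = 0" by transfer (simp add: lpa_family_simps)
  show "a - b = a + - b" by transfer (simp add: lpa_family_simps)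
  show "a * b * c = a * (b * c)" by transfer (simp add: lpa_family_simps mult.assoc)
  show "(a + b) * c = a * c + b * c" by transfer (simp add: lpa_family_simps distrib_right)
  show "a * (b + c) = a * b + a * c" by transfer (simp add: lpa_family_simps distrib_left)
qed

end

lift_definition lpa_scale :: "'r \<Rightarrow> ('v, 'e, 'r::{comm_ring, comm_monoid_mult}) lpa_prod \<Rightarrow> ('v, 'e, 'r) lpa_prod"
  is "\<lambda>r f E. free_smult r (f E)"
  unfolding lpa_family_rel_def free_smult_diff[symmetric] by (blast intro: free_lpa_smult lpa_ideal.smult)

lift_definition lpa_involution :: "('v, 'e, 'r::{comm_ring, comm_monoid_mult}) lpa_prod \<Rightarrow> ('v, 'e, 'r) lpa_prod"
  is "\<lambda>f E. free_star (f E)"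
  unfolding lpa_family_rel_def free_star_diff[symmetric] by (blast intro: free_star_free free_star_ideal)

lift_definition lpa_deg :: "int \<Rightarrow> ('v, 'e, 'r::{comm_ring, comm_monoid_mult}) lpa_prod \<Rightarrow> ('v, 'e, 'r) lpa_prod"
  is "\<lambda>n f E. free_deg n (f E)"
  unfolding lpa_family_rel_def free_deg_diff[symmetric] by (blast intro: free_deg_free free_deg_ideal)

text \<open>The value is 0 at the other graphs, and also for \<open>p\<close> outside
  \<open>free_lpa E\<close>, where the family would otherwise leave the domain of the partial
  quotient.\<close>

lift_definition lpa_in :: "('v, 'e) pre_digraph \<Rightarrow> ('v, 'e, 'r::{comm_ring, comm_monoid_mult}) free_alg \<Rightarrow> ('v, 'e, 'r) lpa_prod"
  is "\<lambda>E p E'. if E' = E \<and> p \<in> free_lpa E then p else 0"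
  by (simp add: lpa_family_rel_def free_lpa_zero lpa_ideal.zero)

lemma lpa_family_rel_eqI:
  assumes "\<And>E. f E = g E" "\<And>E. f E \<in> free_lpa E" shows "lpa_family_rel f g"
  using assms by (simp add: lpa_family_rel_def lpa_ideal.zero)

lemma lpa_family_rel_factor:
  assumes "p \<in> free_lpa E" "q \<in> free_lpa E"
  shows "lpa_family_rel (\<lambda>E'. if E' = E \<and> p \<in> free_lpa E then p else 0)
      (\<lambda>E'. if E' = E \<and> q \<in> free_lpa E then q else 0) \<longleftrightarrow> p - q \<in> lpa_ideal E"
  unfolding lpa_family_rel_def
proof (intro iffI allI)
  assume a: "\<forall>E'. (if E' = E \<and> p \<in> free_lpa E then p else 0) \<in> free_lpa E' \<and>
    (if E' = E \<and> q \<in> free_lpa E then q else 0) \<in> free_lpa E' \<and>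
    (if E' = E \<and> p \<in> free_lpa E then p else 0) - (if E' = E \<and> q \<in> free_lpa E then q else 0) \<in> lpa_ideal E'"
  from a[THEN spec[of _ E]] show "p - q \<in> lpa_ideal E" using assms by simp
next
  fix E'
  assume "p - q \<in> lpa_ideal E"
  then show "(if E' = E \<and> p \<in> free_lpa E then p else 0) \<in> free_lpa E' \<and>
    (if E' = E \<and> q \<in> free_lpa E then q else 0) \<in> free_lpa E' \<and>
    (if E' = E \<and> p \<in> free_lpa E then p else 0) - (if E' = E \<and> q \<in> free_lpa E then q else 0) \<in> lpa_ideal E'"
    using assms by (cases "E' = E") (simp_all add: free_lpa_zero lpa_ideal.zero)
qed

lemma lpa_in_eq_iff:
  "p \<in> free_lpa E \<Longrightarrow> q \<in> free_lpa E \<Longrightarrow> lpa_in E p = lpa_in E q \<longleftrightarrow> p - q \<in> lpa_ideal E"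
  by (transfer fixing: E p q) (rule lpa_family_rel_factor)

lemma lpa_in_zero: "lpa_in E 0 = 0"
  by (transfer fixing: E) (rule lpa_family_rel_eqI, simp_all add: free_lpa_zero)

lemma lpa_in_add: "p \<in> free_lpa E \<Longrightarrow> q \<in> free_lpa E \<Longrightarrow> lpa_in E (p + q) = lpa_in E p + lpa_in E q"
  by (transfer fixing: E p q) (rule lpa_family_rel_eqI, simp_all add: free_lpa_zero free_lpa_add)

lemma lpa_in_mult: "p \<in> free_lpa E \<Longrightarrow> q \<in> free_lpa E \<Longrightarrow> lpa_in E (p * q) = lpa_in E p * lpa_in E q"
  by (transfer fixing: E p q) (rule lpa_family_rel_eqI, simp_all add: free_lpa_zero free_lpa_mult)

lemma lpa_in_scale: "p \<in> free_lpa E \<Longrightarrow> lpa_in E (free_smult r p) = lpa_scale r (lpa_in E p)"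
  by (transfer fixing: E p r) (rule lpa_family_rel_eqI, simp_all add: free_lpa_zero free_lpa_smult free_smult_def[of _ 0])

lemma lpa_in_star: "p \<in> free_lpa E \<Longrightarrow> lpa_in E (free_star p) = lpa_involution (lpa_in E p)"
  by (transfer fixing: E p) (rule lpa_family_rel_eqI, simp_all add: free_lpa_zero free_star_free free_star_zero)

lemma lpa_in_deg: "p \<in> free_lpa E \<Longrightarrow> lpa_in E (free_deg n p) = lpa_deg n (lpa_in E p)"
  by (transfer fixing: E p n) (rule lpa_family_rel_eqI, simp_all add: free_lpa_zero free_deg_free)

text \<open>The element \<open>x\<close> may be any member of the product over all graphs: at the
  factors other than \<open>E\<close> both sides are zero.\<close>

lemma lpa_deg_mult_left:
  assumes "gs \<noteq> []" "set gs \<subseteq> lgens E"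
  shows "lpa_deg n (lpa_in E (word_mono gs) * x) = lpa_in E (word_mono gs) * lpa_deg (n - sum_list (map gen_degree gs)) x"
proof (transfer fixing: E gs n, goal_cases)
  case (1 x)
  then have x: "x E' \<in> free_lpa E'" for E' by (simp add: lpa_family_rel_def)
  show ?case
    by (rule lpa_family_rel_eqI)
      (simp_all add: free_lpa_mono[OF assms] x free_lpa_zero free_lpa_mult free_deg_free,
        simp add: word_mono_def free_deg_mult_left word_degree_def)
qed

lemma lpa_deg_mult_right:
  assumes "gs \<noteq> []" "set gs \<subseteq> lgens E"
  shows "lpa_deg n (x * lpa_in E (word_mono gs)) = lpa_deg (n - sum_list (map gen_degree gs)) x * lpa_in E (word_mono gs)"
proof (transfer fixing: E gs n, goal_cases)
  case (1 x)
  then have x: "x E' \<in> free_lpa E'" for E' by (simp add: lpa_family_rel_def)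
  show ?case
    by (rule lpa_family_rel_eqI)
      (simp_all add: free_lpa_mono[OF assms] x free_lpa_zero free_lpa_mult free_deg_free,
        simp add: word_mono_def free_deg_mult_right word_degree_def)
qed

abbreviation lpa_gen :: "('v, 'e) pre_digraph \<Rightarrow> ('v, 'e) lgen \<Rightarrow> ('v, 'e, 'r::{comm_ring, comm_monoid_mult}) lpa_prod" where
  "lpa_gen E g \<equiv> lpa_in E (word_mono [g])"

lemma word_mono_append: "word_mono (gs @ hs) = word_mono gs * word_mono hs"
  by (simp add: word_mono_def mult_single plus_gword_def)

lemma lpa_in_sum: "(\<And>i. i \<in> A \<Longrightarrow> f i \<in> free_lpa E) \<Longrightarrow> lpa_in E (sum f A) = (\<Sum>i\<in>A. lpa_in E (f i))"
  by (induction A rule: infinite_finite_induct) (auto simp: lpa_in_zero lpa_in_add free_lpa_sum)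

lemma lpa_gen_mult:
  assumes "g \<in> lgens E" "h \<in> lgens E"
  shows "lpa_gen E g * lpa_gen E h = lpa_in E (word_mono [g, h])"
  using assms by (simp add: free_lpa_mono flip: lpa_in_mult word_mono_append)

lemma lpa_gen_mult_eq:
  fixes E :: "('v, 'e) pre_digraph"
  assumes "g \<in> lgens E" "h \<in> lgens E" "p \<in> free_lpa E"
    "word_mono [g, h] - p \<in> (lpa_relations E :: ('v, 'e, 'r::{comm_ring, comm_monoid_mult}) free_alg set)"
  shows "lpa_gen E g * lpa_gen E h = lpa_in E p"
  unfolding lpa_gen_mult[OF assms(1,2)]
  using assms by (subst lpa_in_eq_iff) (auto intro: free_lpa_mono lpa_ideal.rel)

lemma lpa_involution_gen: "g \<in> lgens E \<Longrightarrow> lpa_involution (lpa_gen E g) = lpa_gen E (gen_star g)"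
  by (simp add: free_star_word_mono free_lpa_mono flip: lpa_in_star)


section \<open>The ring type satisfies the Leavitt ring axioms\<close>

lemma free_star_star: "free_star (free_star p) = p"
  by (induction p rule: pm_induct) (simp_all add: free_star_single free_star_add)

lemma free_smult_add: "free_smult r (p + q) = free_smult r p + free_smult r q"
  by (simp add: free_smult_def distrib_left)

lemma free_smult_plus: "free_smult (r + s) p = free_smult r p + free_smult s p"
  by (simp add: free_smult_def single_add distrib_right)

lemma free_smult_smult: "free_smult r (free_smult s p) = free_smult (r * s) p"
  by (simp add: free_smult_def mult_single flip: mult.assoc)

lemma free_smult_one: "free_smult 1 p = p"
  by (induction p rule: pm_induct) (simp_all add: free_smult_def mult_single distrib_left)

lemma free_smult_mult: "free_smult r p * q = free_smult r (p * q)"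
  by (simp add: free_smult_def mult.assoc)

text \<open>The generator identities come from the defining relations, and the laws for the
  operations hold already in the free algebra. Torsion-freeness rests on the representation by
  functions.\<close>

lemma leavitt_ring_lpa:
  assumes "wf_digraph E"
  shows "leavitt_ring E (\<lambda>v. lpa_gen E (Vert v)) (\<lambda>e. lpa_gen E (Edge e))
    (lpa_scale :: 'r \<Rightarrow> ('v, 'e, 'r::{comm_ring, comm_monoid_mult}) lpa_prod \<Rightarrow> _) lpa_involution lpa_deg"
proof -
  interpret wf_digraph E by fact
  note fam = lpa_family_rel_def free_star_free free_lpa_smult free_deg_free free_lpa_add free_lpa_mult
  have V: "Vert v \<in> lgens E" if "v \<in> verts E" for v using that by (simp add: lgens_def)
  have Ed: "Edge e \<in> lgens E" "Ghost e \<in> lgens E" if "e \<in> arcs E" for e using that by (simp_all add: lgens_def)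
  have word: "word_mono [g] \<in> free_lpa E" if "g \<in> lgens E" for g using that by (simp add: free_lpa_mono)
  have star: "lpa_involution (lpa_gen E (Edge e)) = lpa_gen E (Ghost e)" if "e \<in> arcs E" for e
    by (simp add: lpa_involution_gen Ed that)
  show ?thesis
  proof (unfold_locales, goal_cases)
    case (1 u v)
    show ?case
      using lpa_gen_mult_eq[where 'r = 'r, OF V V word[OF V], of u v u] lpa_gen_mult_eq[where 'r = 'r, OF V V free_lpa_zero, of u v] 1
      by (auto simp: lpa_in_zero intro: lpa_relations.intros)
  next
    case (2 e)
    then show ?case using lpa_gen_mult_eq[where 'r = 'r, OF V Ed(1) word[OF Ed(1)]] by (simp add: lpa_relations.intros)
  next
    case (3 e)
    then show ?case using lpa_gen_mult_eq[where 'r = 'r, OF Ed(1) V word[OF Ed(1)]] by (simp add: lpa_relations.intros)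
  next
    case (4 e f)
    show ?case
      using lpa_gen_mult_eq[where 'r = 'r, OF Ed(2) Ed(1) word[OF V], of e f "head E e"] lpa_gen_mult_eq[where 'r = 'r, OF Ed(2) Ed(1) free_lpa_zero, of e f] 4
      by (auto simp: star lpa_in_zero intro: lpa_relations.intros)
  next
    case (5 v)
    have free: "word_mono [Edge e, Ghost e] \<in> free_lpa E" if "e \<in> out_arcs E v" for e
      using that Ed by (auto intro!: free_lpa_mono)
    have "lpa_gen E (Vert v) = lpa_in E (\<Sum>e\<in>out_arcs E v. word_mono [Edge e, Ghost e])"
      using 5 by (subst lpa_in_eq_iff)
        (auto intro!: word V free_lpa_sum free lpa_ideal.rel lpa_relations.CK2 simp: regular_vertex_def)
    also have "\<dots> = (\<Sum>e\<in>out_arcs E v. lpa_in E (word_mono [Edge e, Ghost e]))"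
      by (rule lpa_in_sum) (rule free)
    finally show ?case using Ed by (simp add: star lpa_gen_mult)
  next
    case (6 x y)
    show ?case
      by (transfer, rule lpa_family_rel_eqI)
        (simp_all add: fam free_star_add)
  next
    case (7 x y)
    show ?case
      by (transfer, rule lpa_family_rel_eqI)
        (simp_all add: fam free_star_mult)
  next
    case (8 x)
    show ?case
      by (transfer, rule lpa_family_rel_eqI)
        (simp_all add: fam free_star_star)
  next
    case (9 v)
    then show ?case by (simp add: lpa_involution_gen V)
  next
    case (10 r x)
    show ?case
      by (transfer fixing: r, rule lpa_family_rel_eqI)
        (simp_all add: fam free_star_smult)
  next
    case (11 r x y)
    show ?case
      by (transfer fixing: r, rule lpa_family_rel_eqI)
        (simp_all add: fam free_smult_add)
  next
    case (12 r s x)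
    show ?case
      by (transfer fixing: r s, rule lpa_family_rel_eqI)
        (simp_all add: fam free_smult_plus)
  next
    case (13 r s x)
    show ?case
      by (transfer fixing: r s, rule lpa_family_rel_eqI)
        (simp_all add: fam free_smult_smult)
  next
    case (14 x)
    show ?case
      by (transfer, rule lpa_family_rel_eqI)
        (simp_all add: fam free_smult_one)
  next
    case (15 r x y)
    show ?case
      by (transfer fixing: r, rule lpa_family_rel_eqI)
        (simp_all add: fam free_smult_mult)
  next
    case (16 x r y)
    show ?case
      by (transfer fixing: r, rule lpa_family_rel_eqI)
        (simp_all add: fam free_smult_commute)
  next
    case (17 v r)
    then have "free_smult r (word_mono [Vert v]) - 0 \<in> (lpa_ideal E :: ('v, 'e, 'r) free_alg set)"
      by (subst lpa_in_eq_iff[symmetric]) (simp_all add: lpa_in_scale lpa_in_zero word V free_lpa_smult free_lpa_zero)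
    then show ?case using vertex_torsion_free by simp
  next
    case (18 n x y)
    show ?case
      by (transfer fixing: n, rule lpa_family_rel_eqI)
        (simp_all add: fam free_deg_add)
  next
    case (19 n r x)
    show ?case
      by (transfer fixing: n r, rule lpa_family_rel_eqI)
        (simp_all add: fam free_deg_smult)
  next
    case (20 v n)
    then show ?case
      by (simp add: word V free_deg_word_mono lpa_in_zero flip: lpa_in_deg)
  next
    case (21 e n x)
    then show ?case using lpa_deg_mult_left[where gs = "[Edge e]" and E = E and n = n and x = x] by (simp add: lgens_def)
  next
    case (22 e n x)
    then show ?case using lpa_deg_mult_right[where gs = "[Edge e]" and E = E and n = n and x = x] by (simp add: lgens_def)
  next
    case (23 v n x)
    then show ?case using lpa_deg_mult_left[where gs = "[Vert v]" and E = E and n = n and x = x] by (simp add: lgens_def)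
  next
    case (24 v n x)
    then show ?case using lpa_deg_mult_right[where gs = "[Vert v]" and E = E and n = n and x = x] by (simp add: lgens_def)
  next
    case (25 e n x)
    then show ?case using lpa_deg_mult_left[where gs = "[Ghost e]" and E = E and n = n and x = x] by (simp add: lgens_def star)
  next
    case (26 e n x)
    then show ?case using lpa_deg_mult_right[where gs = "[Ghost e]" and E = E and n = n and x = x] by (simp add: lgens_def star)
  qed
qed


section \<open>Transfer to classes\<close>

definition path_word :: "'v \<Rightarrow> 'e list \<Rightarrow> ('v, 'e) lgen list" where
  "path_word u p = (if p = [] then [Vert u] else map Edge p)"

text \<open>The type argument only fixes the coefficient ring.\<close>

locale lpa = wf_digraph E for E :: "('v, 'e) pre_digraph" +
  fixes R :: "'r::{comm_ring, comm_monoid_mult} itself"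
begin

sublocale leavitt_ring E "\<lambda>v. lpa_gen E (Vert v)" "\<lambda>e. lpa_gen E (Edge e)"
  "lpa_scale :: 'r \<Rightarrow> ('v, 'e, 'r) lpa_prod \<Rightarrow> _" lpa_involution lpa_deg
  using leavitt_ring_lpa wf_digraph_axioms .

abbreviation free :: "('v, 'e, 'r) free_alg set" where "free \<equiv> free_lpa E"
abbreviation cls :: "('v, 'e, 'r) free_alg \<Rightarrow> ('v, 'e, 'r) lpa_elt" where "cls \<equiv> lpa_class E"
abbreviation inn :: "('v, 'e, 'r) free_alg \<Rightarrow> ('v, 'e, 'r) lpa_prod" where "inn \<equiv> lpa_in E"

lemma cls_eq_iff: "p \<in> free \<Longrightarrow> q \<in> free \<Longrightarrow> cls p = cls q \<longleftrightarrow> inn p = inn q"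
  by (simp add: lpa_class_eq_iff lpa_in_eq_iff)

lemma path_word_free: "awalk u p w \<Longrightarrow> word_mono (path_word u p) \<in> free"
  by (intro free_lpa_mono) (auto simp: path_word_def lgens_def awalk_def)

lemma inn_path_word: "awalk u p w \<Longrightarrow> inn (word_mono (path_word u p)) = pe u p"
proof (induction p arbitrary: u)
  case Nil then show ?case by (simp add: path_word_def)
next
  case (Cons e p)
  then have e: "e \<in> arcs E" "awalk (head E e) p w" by (auto simp: awalk_Cons_iff)
  have Ede: "word_mono [Edge e] \<in> free" using e by (intro free_lpa_mono) (auto simp: lgens_def)
  show ?case
  proof (cases p)
    case Nil then show ?thesis using Ed_head[OF e(1)] by (simp add: path_word_def)
  next
    case (Cons f p')
    then have "path_word u (e # p) = [Edge e] @ path_word (head E e) p" by (simp add: path_word_def)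
    then show ?thesis
      using Cons.IH[OF e(2)] path_word_free[OF e(2)] Ede by (simp only: word_mono_append lpa_in_mult pe.simps)
  qed
qed

definition path_mono :: "'v \<Rightarrow> 'e list \<Rightarrow> 'v \<Rightarrow> 'e list \<Rightarrow> ('v, 'e, 'r) free_alg" where
  "path_mono u p u' q = word_mono (path_word u p) * free_star (word_mono (path_word u' q))"

lemma path_mono_free: "awalk u p w \<Longrightarrow> awalk u' q w \<Longrightarrow> path_mono u p u' q \<in> free"
  by (simp add: path_mono_def free_lpa_mult free_star_free path_word_free)

lemma inn_path_mono: "awalk u p w \<Longrightarrow> awalk u' q w \<Longrightarrow> inn (path_mono u p u' q) = pe u p * ge u' q"
  by (simp add: path_mono_def lpa_in_mult free_star_free path_word_free lpa_in_star inn_path_word)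

lemma path_elt_mult_star:
  assumes "awalk u p w" "awalk u' q w"
  shows "lpa_mult E (path_elt E (u, p, w)) (lpa_star E (path_elt E (u', q, w))) = cls (path_mono u p u' q)"
  using path_word_free[OF assms(1)] path_word_free[OF assms(2)]
  by (simp add: path_mono_def lpa_star_class lpa_mult_class free_star_free flip: path_word_def)

lemma path_monomials_eq: "path_monomials E = {cls (path_mono u p u' q) | u p u' q w. awalk u p w \<and> awalk u' q w}"
proof (intro set_eqI iffI)
  fix x :: "('v, 'e, 'r) lpa_elt"
  assume "x \<in> path_monomials E"
  then obtain u p u' q w where "x = lpa_mult E (path_elt E (u, p, w)) (lpa_star E (path_elt E (u', q, w)))"
    "awalk u p w" "awalk u' q w"
    by (auto simp: path_monomials_def Path_def path_range_def simp del: path_elt.simps)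
  then show "x \<in> {cls (path_mono u p u' q) | u p u' q w. awalk u p w \<and> awalk u' q w}"
    using path_elt_mult_star by blast
next
  fix x :: "('v, 'e, 'r) lpa_elt"
  assume "x \<in> {cls (path_mono u p u' q) | u p u' q w. awalk u p w \<and> awalk u' q w}"
  then obtain u p u' q w where x: "x = cls (path_mono u p u' q)" "awalk u p w" "awalk u' q w" by blast
  then have "(u, p, w) \<in> Path E" "(u', q, w) \<in> Path E" "path_range (u, p, w) = path_range (u', q, w)"
    by (simp_all add: Path_def path_range_def)
  then show "x \<in> path_monomials E"
    unfolding path_monomials_def x(1) path_elt_mult_star[OF x(2,3), symmetric] by blast
qed

lemma lpa_normal_iff:
  assumes a: "awalk u p w" "awalk u' q w"
  shows "lpa_normal E (cls (path_mono u p u' q)) \<longleftrightarrow> cyl u p = cyl u' q"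
proof -
  let ?m = "path_mono u p u' q"
  have m: "?m \<in> free" "free_star ?m \<in> free" using path_mono_free[OF a] by (simp_all add: free_star_free)
  have "inn (?m * free_star ?m) = pe u p * ge u' q * (pe u' q * ge u p)"
    using m by (simp add: lpa_in_mult lpa_in_star inn_path_mono[OF a] star_mult)
  also have "\<dots> = pe u p * lpa_gen E (Vert w) * ge u p" by (simp only: ge_pe_same[OF a(2), symmetric] mult.assoc)
  also have "\<dots> = cyl u p" using pe_V[OF a(1)] by (simp add: cyl_def)
  finally have 1: "inn (?m * free_star ?m) = cyl u p" .
  have "inn (free_star ?m * ?m) = pe u' q * ge u p * (pe u p * ge u' q)"
    using m by (simp add: lpa_in_mult lpa_in_star inn_path_mono[OF a] star_mult)
  also have "\<dots> = pe u' q * lpa_gen E (Vert w) * ge u' q" by (simp only: ge_pe_same[OF a(1), symmetric] mult.assoc)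
  also have "\<dots> = cyl u' q" using pe_V[OF a(2)] by (simp add: cyl_def)
  finally have 2: "inn (free_star ?m * ?m) = cyl u' q" .
  show ?thesis
    using m 1 2 by (simp add: lpa_normal_def lpa_star_class lpa_mult_class cls_eq_iff free_lpa_mult)
qed

lemma normal_monomials_eq:
  "{x \<in> path_monomials E. lpa_normal E x} = {cls (path_mono u p u' q) | u p u' q w.
     awalk u p w \<and> awalk u' q w \<and> cyl u p = cyl u' q}"
  unfolding path_monomials_eq using lpa_normal_iff by blast

lemma inn_word: "gs \<noteq> [] \<Longrightarrow> set gs \<subseteq> lgens E \<Longrightarrow> inn (word_mono gs) \<in> span monomials"
proof (induction gs)
  case Nil then show ?case by simp
next
  case (Cons g gs)
  have mult: "lpa_gen E g * x \<in> span monomials" if "x \<in> span monomials" for x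
  proof (rule span_mult_left[OF _ that])
    fix x assume x: "x \<in> monomials"
    show "lpa_gen E g * x \<in> span monomials"
    proof (cases g)
      case (Vert v) then show ?thesis using V_mult_monomial x Cons.prems by (auto simp: lgens_def)
    next
      case (Edge e) then show ?thesis using Ed_mult_monomial x Cons.prems by (auto simp: lgens_def)
    next
      case (Ghost e)
      then have e: "e \<in> arcs E" using Cons.prems by (auto simp: lgens_def)
      then have "lpa_involution (lpa_gen E (Edge e)) = (lpa_gen E g :: ('v, 'e, 'r) lpa_prod)"
        using Ghost by (subst lpa_involution_gen) (auto simp: lgens_def)
      then show ?thesis using star_Ed_mult_monomial[OF e x] by simp
    qed
  qed
  show ?case
  proof (cases "gs = []")
    case True
    \<comment> \<open>The vertex that is neutral on the right of the letter \<open>g\<close>. It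
      lets a word of one letter arise from a vertex monomial by left multiplication.\<close>
    define v where "v = (case g of Vert v \<Rightarrow> v | Edge e \<Rightarrow> head E e | Ghost e \<Rightarrow> tail E e)"
    have v: "v \<in> verts E" using Cons.prems by (auto simp: v_def lgens_def split: lgen.splits)
    have g: "g \<in> lgens E" using Cons.prems by simp
    have "lpa_gen E g * lpa_gen E (Vert v) = lpa_in E (word_mono [g] :: ('v, 'e, 'r) free_alg)"
    proof (rule lpa_gen_mult_eq)
      show "word_mono [g, Vert v] - word_mono [g] \<in> (lpa_relations E :: ('v, 'e, 'r) free_alg set)"
        using g by (cases g) (auto simp: v_def lgens_def intro: lpa_relations.intros)
    qed (use g v in \<open>auto simp: lgens_def intro!: free_lpa_mono\<close>)
    then show ?thesis using mult[OF span_base[OF V_monomials[OF v]]] True by simp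
  next
    case False
    have "word_mono (g # gs) = (word_mono [g] * word_mono gs :: ('v, 'e, 'r) free_alg)"
      by (simp flip: word_mono_append)
    then have "inn (word_mono (g # gs)) = lpa_gen E g * inn (word_mono gs)"
      using Cons.prems False by (simp add: free_lpa_mono lpa_in_mult)
    then show ?thesis using mult Cons False by simp
  qed
qed

lemma inn_span:
  assumes "p \<in> free" shows "inn p \<in> span monomials"
proof -
  \<comment> \<open>Membership is carried through the induction because \<open>lpa_in\<close> is
    additive only on elements of the free algebra of \<open>E\<close>.\<close>
  have "p \<in> free \<and> inn p \<in> span monomials"
    using assms
  proof (induction rule: free_lpa_induct)
    case zero then show ?case by (simp add: lpa_in_zero span_zero free_lpa_zero)
  next
    case (single w a)
    have "Poly_Mapping.single w a = free_smult a (word_mono (letters w))"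
      by (simp add: free_smult_def word_mono_def mult_single)
    then show ?case using single inn_word by (simp add: lpa_in_scale free_lpa_mono free_lpa_smult span_sc)
  next
    case (add p q)
    then show ?case by (simp add: lpa_in_add free_lpa_add span_add)
  qed
  then show ?thesis by simp
qed

section \<open>Generated subalgebras and commutants of classes\<close>

lemma lpa_rep: "x \<in> LPA E \<Longrightarrow> (\<And>p. p \<in> free \<Longrightarrow> x = cls p \<Longrightarrow> thesis) \<Longrightarrow> thesis"
  by (auto simp: LPA_eq_image)

lemma cls_LPA: "p \<in> free \<Longrightarrow> cls p \<in> LPA E"
  by (simp add: LPA_eq_image)

lemma subalgebra_LPA: "lpa_subalgebra E (LPA E :: ('v, 'e, 'r) lpa_elt set)"
  by (auto simp: lpa_subalgebra_def LPA_eq_image lpa_zero_def lpa_add_class lpa_mult_class lpa_smult_class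
    intro!: imageI free_lpa_zero free_lpa_add free_lpa_mult free_lpa_smult)

lemma subalgebra_generated:
  assumes "X \<subseteq> (LPA E :: ('v, 'e, 'r) lpa_elt set)"
  shows "lpa_subalgebra E (generated_subalgebra E X)"
proof -
  have "generated_subalgebra E X \<subseteq> LPA E" using subalgebra_LPA assms by (auto simp: generated_subalgebra_def)
  then show ?thesis by (auto simp: lpa_subalgebra_def generated_subalgebra_def)
qed

lemma generated_subset: "lpa_subalgebra E S \<Longrightarrow> X \<subseteq> S \<Longrightarrow> generated_subalgebra E X \<subseteq> S"
  by (auto simp: generated_subalgebra_def)

lemma generated_superset: "X \<subseteq> generated_subalgebra E X"
  by (auto simp: generated_subalgebra_def)

definition commutant :: "('v, 'e, 'r) lpa_elt set \<Rightarrow> ('v, 'e, 'r) lpa_elt set" where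
  "commutant X = {x \<in> LPA E. \<forall>y\<in>X. lpa_mult E x y = lpa_mult E y x}"

lemma subalgebra_commutant:
  assumes "X \<subseteq> LPA E" shows "lpa_subalgebra E (commutant X)"
proof -
  have zero: "lpa_zero E \<in> commutant X"
    using assms free_lpa_zero
    by (auto simp: commutant_def lpa_zero_def LPA_eq_image lpa_mult_class)
  have closed: "lpa_add E x y \<in> commutant X" "lpa_mult E x y \<in> commutant X" "lpa_smult E a x \<in> commutant X"
    if xy: "x \<in> commutant X" "y \<in> commutant X" for x y a
  proof -
    from xy obtain p q where p: "p \<in> free" "x = cls p" and q: "q \<in> free" "y = cls q"
      by (auto simp: commutant_def elim!: lpa_rep)
    note ops = lpa_mult_class lpa_add_class lpa_smult_class cls_eq_iff lpa_in_mult lpa_in_add lpa_in_scale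
      free_lpa_add free_lpa_mult free_lpa_smult
    have comm: "inn p * inn z = inn z * inn p" "inn q * inn z = inn z * inn q" if "z \<in> free" "cls z \<in> X" for z
      using xy that p q by (auto simp: commutant_def ops)
    have "lpa_add E x y \<in> commutant X \<and> lpa_mult E x y \<in> commutant X \<and> lpa_smult E a x \<in> commutant X"
    proof (unfold commutant_def mem_Collect_eq, intro conjI ballI)
      show "lpa_add E x y \<in> LPA E" "lpa_mult E x y \<in> LPA E" "lpa_smult E a x \<in> LPA E"
        using p q by (simp_all add: ops cls_LPA)
      fix t assume "t \<in> X"
      then obtain z where z: "z \<in> free" "t = cls z" "cls z \<in> X" using assms by (blast elim: lpa_rep)
      note c = comm[OF z(1,3)]
      show "lpa_mult E (lpa_add E x y) t = lpa_mult E t (lpa_add E x y)"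
        using p q z c by (simp add: ops distrib_left distrib_right)
      show "lpa_mult E (lpa_smult E a x) t = lpa_mult E t (lpa_smult E a x)"
        using p z c by (simp add: ops sc_mult_left sc_mult_right)
      have "inn p * inn q * inn z = inn z * (inn p * inn q)"
        by (metis c mult.assoc)
      then show "lpa_mult E (lpa_mult E x y) t = lpa_mult E t (lpa_mult E x y)"
        using p q z by (simp add: ops)
    qed
    then show "lpa_add E x y \<in> commutant X" "lpa_mult E x y \<in> commutant X" "lpa_smult E a x \<in> commutant X"
      by auto
  qed
  then show ?thesis using zero by (auto simp: lpa_subalgebra_def commutant_def)
qed

text \<open>Since commutants are subalgebras, two passes suffice: the generated algebra first
  commutes with the generators, then with itself.\<close>

lemma commutative_generated:
  assumes X: "X \<subseteq> (LPA E :: ('v, 'e, 'r) lpa_elt set)" and comm: "\<And>x y. x \<in> X \<Longrightarrow> y \<in> X \<Longrightarrow> lpa_mult E x y = lpa_mult E y x"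
  shows "commutative_subalgebra E (generated_subalgebra E X)"
proof -
  let ?G = "generated_subalgebra E X"
  have G: "lpa_subalgebra E ?G" "?G \<subseteq> LPA E"
    using subalgebra_generated[OF X] by (auto simp: lpa_subalgebra_def)
  have "X \<subseteq> commutant X" using X comm by (auto simp: commutant_def)
  then have "?G \<subseteq> commutant X" by (rule generated_subset[OF subalgebra_commutant[OF X]])
  then have "X \<subseteq> commutant ?G" using X by (fastforce simp: commutant_def)
  then have "?G \<subseteq> commutant ?G" by (rule generated_subset[OF subalgebra_commutant[OF G(2)]])
  then show ?thesis using G(1) by (auto simp: commutative_subalgebra_def commutant_def)
qed

text \<open>Brings a membership proved in the ring type back to classes: each closure rule of
  \<open>alg\<close> is matched by the corresponding operation on representatives.\<close>

lemma core_representative: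
  assumes "y \<in> alg normals"
  shows "\<exists>p. p \<in> free \<and> inn p = y \<and> cls p \<in> (commutative_core E :: ('v, 'e, 'r) lpa_elt set)"
proof -
  let ?X = "{x \<in> path_monomials E :: ('v, 'e, 'r) lpa_elt set. lpa_normal E x}"
  have X: "?X \<subseteq> LPA E" unfolding path_monomials_eq using path_mono_free cls_LPA by blast
  note sub = subalgebra_generated[OF X, folded commutative_core_def, unfolded lpa_subalgebra_def]
  show ?thesis
    using assms
  proof induction
    case alg_zero
    then show ?case using sub by (auto intro!: exI[of _ 0] simp: lpa_in_zero free_lpa_zero simp flip: lpa_zero_def)
  next
    case (alg_base x)
    then obtain u p u' q w where x: "x = pe u p * ge u' q" "awalk u p w" "awalk u' q w" "cyl u p = cyl u' q"
      unfolding normals_def by blast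
    then have "cls (path_mono u p u' q) \<in> ?X" unfolding normal_monomials_eq by blast
    then have "cls (path_mono u p u' q) \<in> commutative_core E"
      unfolding commutative_core_def by (rule subsetD[OF generated_superset])
    then show ?case using path_mono_free[OF x(2,3)] inn_path_mono[OF x(2,3)] x(1) by blast
  next
    case (alg_add x y)
    then obtain p q where "p \<in> free" "inn p = x" "cls p \<in> commutative_core E"
      "q \<in> free" "inn q = y" "cls q \<in> commutative_core E" by blast
    then show ?case using sub
      by (intro exI[of _ "p + q"]) (auto simp: free_lpa_add lpa_in_add simp flip: lpa_add_class)
  next
    case (alg_mult x y)
    then obtain p q where "p \<in> free" "inn p = x" "cls p \<in> commutative_core E"
      "q \<in> free" "inn q = y" "cls q \<in> commutative_core E" by blast
    then show ?case using sub
      by (intro exI[of _ "p * q"]) (auto simp: free_lpa_mult lpa_in_mult simp flip: lpa_mult_class)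
  next
    case (alg_sc x a)
    then obtain p where "p \<in> free" "inn p = x" "cls p \<in> commutative_core E" by blast
    then show ?case using sub
      by (intro exI[of _ "free_smult a p"]) (auto simp: free_lpa_smult lpa_in_scale simp flip: lpa_smult_class)
  qed
qed

theorem commutative_core_properties:
  defines "M \<equiv> commutative_core E :: ('v, 'e, 'r) lpa_elt set"
  shows "M = commutant (diagonal_algebra E)" "maximal_commutative_subalgebra E M"
proof -
  let ?X = "{x \<in> path_monomials E :: ('v, 'e, 'r) lpa_elt set. lpa_normal E x}"
  let ?D = "{lpa_mult E (path_elt E \<mu>) (lpa_star E (path_elt E \<mu>)) | \<mu>. \<mu> \<in> Path E} :: ('v, 'e, 'r) lpa_elt set"
  have X: "?X \<subseteq> LPA E" unfolding path_monomials_eq using path_mono_free cls_LPA by blast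
  have D_eq: "?D = {cls (path_mono u p u p) | u p w. awalk u p w}"
  proof (intro set_eqI iffI)
    fix x assume "x \<in> ?D"
    then obtain u p w where "x = lpa_mult E (path_elt E (u, p, w)) (lpa_star E (path_elt E (u, p, w)))" "awalk u p w"
      by (auto simp: Path_def simp del: path_elt.simps)
    then show "x \<in> {cls (path_mono u p u p) | u p w. awalk u p w}" using path_elt_mult_star by blast
  next
    fix x assume "x \<in> {cls (path_mono u p u p) | u p w. awalk u p w}"
    then obtain u p w where x: "x = cls (path_mono u p u p)" "awalk u p w" by blast
    then have "(u, p, w) \<in> Path E" by (simp add: Path_def)
    then show "x \<in> ?D" unfolding x(1) path_elt_mult_star[OF x(2,2), symmetric] by blast
  qed
  have "?D \<subseteq> ?X" unfolding D_eq normal_monomials_eq by blast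
  have sub: "lpa_subalgebra E M" unfolding M_def commutative_core_def by (rule subalgebra_generated[OF X])
  have comm: "commutative_subalgebra E M"
    unfolding M_def commutative_core_def
  proof (rule commutative_generated[OF X])
    fix x y assume "x \<in> ?X" "y \<in> ?X"
    moreover have "\<exists>p. p \<in> free \<and> x = cls p \<and> inn p \<in> normals" if xX: "x \<in> ?X" for x
    proof -
      obtain u p u' q w where x: "x = cls (path_mono u p u' q)" "awalk u p w" "awalk u' q w" "cyl u p = cyl u' q"
        using xX unfolding normal_monomials_eq by blast
      then have "inn (path_mono u p u' q) \<in> normals" unfolding inn_path_mono[OF x(2,3)] normals_def by blast
      then show ?thesis using x path_mono_free by blast
    qed
    ultimately obtain p q where "p \<in> free" "q \<in> free" "x = cls p" "y = cls q" "inn p \<in> normals" "inn q \<in> normals"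
      by meson
    then show "lpa_mult E x y = lpa_mult E y x"
      using normals_commute by (simp add: lpa_mult_class cls_eq_iff free_lpa_mult lpa_in_mult)
  qed
  have D_sub: "diagonal_algebra E \<subseteq> M"
  proof -
    have "?X \<subseteq> M" unfolding M_def commutative_core_def by (rule generated_superset)
    then show ?thesis
      unfolding diagonal_algebra_def using \<open>?D \<subseteq> ?X\<close> by (intro generated_subset[OF sub]) (rule subset_trans)
  qed
  have centralizer: "commutant (diagonal_algebra E) \<subseteq> M"
  proof
    fix x assume x: "x \<in> commutant (diagonal_algebra E)"
    then obtain p where p: "p \<in> free" "x = cls p" by (auto simp: commutant_def elim: lpa_rep)
    have "inn p \<in> alg normals"
    proof (rule centralizer_in_core[OF inn_span[OF p(1)]])
      fix u q w assume q: "awalk u q w"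
      have "cls (path_mono u q u q) \<in> ?D" unfolding D_eq using q by blast
      then have "cls (path_mono u q u q) \<in> diagonal_algebra E"
        unfolding diagonal_algebra_def by (rule subsetD[OF generated_superset])
      then have "lpa_mult E x (cls (path_mono u q u q)) = lpa_mult E (cls (path_mono u q u q)) x"
        using x by (simp add: commutant_def)
      then show "inn p * cyl u q = cyl u q * inn p"
        using p path_mono_free[OF q q] inn_path_mono[OF q q]
        by (simp add: lpa_mult_class cls_eq_iff free_lpa_mult lpa_in_mult cyl_def)
    qed
    then obtain p' where "p' \<in> free" "inn p' = inn p" "cls p' \<in> M"
      using core_representative unfolding M_def by blast
    then show "x \<in> M" using p by (metis cls_eq_iff)
  qed
  \<comment> \<open>A commutative algebra above \<open>M\<close> contains the diagonal and so
    centralizes it. With \<open>T = M\<close> this gives the missing inclusion, and for general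
    \<open>T\<close> it gives maximality.\<close>
  have contains: "T \<subseteq> commutant (diagonal_algebra E)" if "commutative_subalgebra E T" "M \<subseteq> T" for T
    using that D_sub by (auto simp: commutant_def commutative_subalgebra_def lpa_subalgebra_def)
  show "M = commutant (diagonal_algebra E)"
    using centralizer contains[OF comm] by blast
  show "maximal_commutative_subalgebra E M"
    unfolding maximal_commutative_subalgebra_def using comm contains centralizer by blast
qed

end

theorem theorem4p13:
  fixes E :: "('v, 'e) pre_digraph"
  assumes "wf_digraph E"
  shows "(commutative_core E :: ('v, 'e, 'r::{comm_ring, comm_monoid_mult}) lpa_elt set)
           = {x \<in> LPA E. \<forall>d \<in> diagonal_algebra E. lpa_mult E x d = lpa_mult E d x}
         \<and> maximal_commutative_subalgebra E
           (commutative_core E :: ('v, 'e, 'r) lpa_elt set)"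
proof -
  interpret wf_digraph E by fact
  interpret lpa E "TYPE('r)" by unfold_locales
  show ?thesis using commutative_core_properties by (simp add: commutant_def)
qed

end
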